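(* Let $x:[0,\infty)\to\mathbb{R}$ be continuous and let $\Pi=(\pi_n)_n$ be a fixed sequence of partitions of $[0,\infty)$ such that $O_t(x,\pi_n)\to0$ as $n\to\infty$ for all $t\in[0,\infty)$. Let $g:\mathbb{R}\to\mathbb{R}$ be a nonnegative $C^2$ function with compact support contained in $[0,\infty)$ and $\int_{\mathbb{R}}g(y)\,dy=1$, and set $g_n(u):=n\,g(nu)$. Assume that $x\in\mathcal{L}_1^\Pi$ and that there exists a modification $L_t(u)$ of the pathwise local time of $x$ which is càdlàg in $u$ for all $t$. If $f:\mathbb{R}\to\mathbb{R}$ is convex and $f_n:=g_n*f$, then $f_n$ is $C^2$ and, for all $t\in[0,\infty)$, the Föllmer integral $\int_0^tf_n'(x_s)\,dx_s$ converges as $n\to\infty$ to a finite limit, denoted by $\int_0^tf'_-(x_s)\,dx_s$, which is independent of the choice of $g$ and satisfies $$f(x_t)-f(x_0)=\int_0^tf'_-(x_s)\,dx_s+\frac12\int_{\mathbb{R}}L_t(u)\,f''(du).$$ Moreover, if $L_t(u)$ is jointly càdlàg in $u$ and continuous in $t$, then the convergence is uniform on compacts (in $t$) and $t\mapsto\int_0^tf'_-(x_s)\,dx_s$ is continuous.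
   Context: A partition of $[0,\infty)$ is a sequence $\pi=(t_k)_{k\in\mathbb{N}}$ in $[0,\infty]$ with $t_0=0$, $t_k<t_{k+1}$ whenever $t_{k+1}<\infty$, and $\lim_k t_k=\infty$; set $x_\infty:=0$. $O_t(x,\pi):=\max\{|x(b)-x(a)|:a,b\in[t_k,t_{k+1})\cap[0,t]\text{ for some }k\}$ (understood as a supremum). For $a,b\in\mathbb{R}$ let $[\![a,b)\!)$ denote $[a,b)$ if $a\le b$ and $[b,a)$ if $a>b$. The discrete local time of $x$ along $\pi$ is $$L^{\pi}_t(u):=2\sum_{t_j\in\pi}\mathbf{1}_{[\![x_{t_j\wedge t},\,x_{t_{j+1}\wedge t})\!)}(u)\,|x_{t_{j+1}\wedge t}-u|.$$ $\mathcal{L}_1^\Pi$ is the set of continuous $x$ with $O_t(x,\pi_n)\to0$ for all $t$ such that, for all $t\in[0,\infty)$, $(L^{\pi_n}_t)_n$ converges weakly in $L^1(\mathbb{R},du)$ to some $L_t\in L^1$ (the pathwise local time), and $t\mapsto L_t\in L^1$ is continuous for the weak topology. A modification of $L$ is a function $\tilde L_t(u)$ such that for each $t$ the set $\{u:\tilde L_t(u)\ne L_t(u)\}$ has zero Lebesgue measure. "Jointly càdlàg in $u$ and continuous in $t$" means that for each $(t,u)$, $L_s(v)\to L_t(u)$ as $s\to t$, $v\to u$ with $v\ge u$, and $L_s(v)$ has a limit as $s\to t$, $v\to u$ with $v<u$. For $x\in\mathcal{L}_1^\Pi$ and $h\in C^1$, the Föllmer integral is $\int_0^th(x_s)\,dx_s:=\lim_n\sum_{t_j\in\pi_n}h(x_{t_j})(x_{t_{j+1}\wedge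 t}-x_{t_j\wedge t})$, a limit which exists. $f'_-$ is the left derivative of $f$ and $f''$ its second distributional derivative, i.e. the Radon measure with $f''([a,b))=f'_-(b)-f'_-(a)$. $*$ denotes convolution. *)

theory Defs
  imports "HOL-Analysis.Analysis"
begin

definition partition_seq :: "(nat \<Rightarrow> ereal) \<Rightarrow> bool" where
  "partition_seq \<pi> \<longleftrightarrow>
     (\<forall>k. 0 \<le> \<pi> k) \<and> \<pi> 0 = 0 \<and>
     (\<forall>k. \<pi> (Suc k) < \<infinity> \<longrightarrow> \<pi> k < \<pi> (Suc k)) \<and>
     \<pi> \<longlonglongrightarrow> \<infinity>"

text \<open>Paths are total functions on the reals of which only the values on \<open>[0, \<infinity>)\<close> matter.
  Evaluation at a time in \<open>[0, \<infinity>]\<close> uses the convention \<open>x\<^sub>\<infinity> = 0\<close>.\<close>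

definition path_at :: "(real \<Rightarrow> real) \<Rightarrow> ereal \<Rightarrow> real" where
  "path_at x s = (if s = \<infinity> then 0 else x (real_of_ereal s))"

definition oscillation :: "(real \<Rightarrow> real) \<Rightarrow> (nat \<Rightarrow> ereal) \<Rightarrow> real \<Rightarrow> real" where
  "oscillation x \<pi> t =
     Sup {\<bar>x b - x a\<bar> | a b k.
            ereal a \<in> {\<pi> k..<\<pi> (Suc k)} \<and> a \<in> {0..t} \<and>
            ereal b \<in> {\<pi> k..<\<pi> (Suc k)} \<and> b \<in> {0..t}}"


definition half_open :: "real \<Rightarrow> real \<Rightarrow> real set" where
  "half_open a b = (if a \<le> b then {a..<b} else {b..<a})"

text \<open>For a partition only finitely many terms of the series are nonzero, since both stopped times
  equal \<open>t\<close> for large \<open>j\<close>.\<close>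

definition discrete_local_time ::
  "(nat \<Rightarrow> ereal) \<Rightarrow> (real \<Rightarrow> real) \<Rightarrow> real \<Rightarrow> real \<Rightarrow> real" where
  "discrete_local_time \<pi> x t u =
     2 * (\<Sum>j. indicator (half_open (path_at x (min (\<pi> j) (ereal t)))
                                   (path_at x (min (\<pi> (Suc j)) (ereal t)))) u *
               \<bar>path_at x (min (\<pi> (Suc j)) (ereal t)) - u\<bar>)"

definition Linf :: "(real \<Rightarrow> real) set" where
  "Linf = {\<phi> \<in> borel_measurable lborel. \<exists>C. AE u in lborel. \<bar>\<phi> u\<bar> \<le> C}"

text \<open>Weak convergence in \<open>L\<^sup>1(\<real>, du)\<close>: convergence against every element of the dual \<open>L\<^sup>\<infinity>\<close>.
  Elements of \<open>L\<^sup>1\<close> are given by representatives.\<close>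

definition weakly_converges_L1 :: "(nat \<Rightarrow> real \<Rightarrow> real) \<Rightarrow> (real \<Rightarrow> real) \<Rightarrow> bool" where
  "weakly_converges_L1 F f \<longleftrightarrow>
     (\<forall>n. integrable lborel (F n)) \<and> integrable lborel f \<and>
     (\<forall>\<phi>\<in>Linf. (\<lambda>n. LINT u|lborel. F n u * \<phi> u) \<longlonglongrightarrow> (LINT u|lborel. f u * \<phi> u))"

definition is_pathwise_local_time ::
  "(nat \<Rightarrow> nat \<Rightarrow> ereal) \<Rightarrow> (real \<Rightarrow> real) \<Rightarrow> (real \<Rightarrow> real \<Rightarrow> real) \<Rightarrow> bool" where
  "is_pathwise_local_time \<pi>s x L \<longleftrightarrow>
     (\<forall>t\<ge>0. weakly_converges_L1 (\<lambda>n. discrete_local_time (\<pi>s n) x t) (L t)) \<and>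
     (\<forall>\<phi>\<in>Linf. continuous_on {0..} (\<lambda>t. LINT u|lborel. L t u * \<phi> u))"

definition L1_paths :: "(nat \<Rightarrow> nat \<Rightarrow> ereal) \<Rightarrow> (real \<Rightarrow> real) set" where
  "L1_paths \<pi>s =
     {x. continuous_on {0..} x \<and> (\<forall>t\<ge>0. (\<lambda>n. oscillation x (\<pi>s n) t) \<longlonglongrightarrow> 0) \<and>
         (\<exists>L. is_pathwise_local_time \<pi>s x L)}"

definition is_modification ::
  "(real \<Rightarrow> real \<Rightarrow> real) \<Rightarrow> (real \<Rightarrow> real \<Rightarrow> real) \<Rightarrow> bool" where
  "is_modification L' L \<longleftrightarrow> (\<forall>t\<ge>0. {u. L' t u \<noteq> L t u} \<in> null_sets lebesgue)"

definition cadlag :: "(real \<Rightarrow> real) \<Rightarrow> bool" where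
  "cadlag \<phi> \<longleftrightarrow> (\<forall>u. (\<phi> \<longlongrightarrow> \<phi> u) (at_right u) \<and> (\<exists>l. (\<phi> \<longlongrightarrow> l) (at_left u)))"

text \<open>In the first limit \<^const>\<open>at\<close> leaves out the point \<open>(t, u)\<close> itself, where the value already is
  the prescribed limit.\<close>

definition jointly_cadlag_continuous :: "(real \<Rightarrow> real \<Rightarrow> real) \<Rightarrow> bool" where
  "jointly_cadlag_continuous L \<longleftrightarrow>
     (\<forall>t\<ge>0. \<forall>u.
        ((\<lambda>(s, v). L s v) \<longlongrightarrow> L t u) (at (t, u) within {0..} \<times> {u..}) \<and>
        (\<exists>l. ((\<lambda>(s, v). L s v) \<longlongrightarrow> l) (at (t, u) within {0..} \<times> {..<u})))"


definition follmer_sum ::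
  "(nat \<Rightarrow> ereal) \<Rightarrow> (real \<Rightarrow> real) \<Rightarrow> (real \<Rightarrow> real) \<Rightarrow> real \<Rightarrow> real" where
  "follmer_sum \<pi> h x t =
     (\<Sum>j. h (path_at x (\<pi> j)) *
          (path_at x (min (\<pi> (Suc j)) (ereal t)) - path_at x (min (\<pi> j) (ereal t))))"

definition follmer_integrable ::
  "(nat \<Rightarrow> nat \<Rightarrow> ereal) \<Rightarrow> (real \<Rightarrow> real) \<Rightarrow> (real \<Rightarrow> real) \<Rightarrow> real \<Rightarrow> bool" where
  "follmer_integrable \<pi>s h x t \<longleftrightarrow> convergent (\<lambda>n. follmer_sum (\<pi>s n) h x t)"

definition follmer_integral ::
  "(nat \<Rightarrow> nat \<Rightarrow> ereal) \<Rightarrow> (real \<Rightarrow> real) \<Rightarrow> (real \<Rightarrow> real) \<Rightarrow> real \<Rightarrow> real" where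
  "follmer_integral \<pi>s h x t = lim (\<lambda>n. follmer_sum (\<pi>s n) h x t)"


definition C2 :: "(real \<Rightarrow> real) \<Rightarrow> bool" where
  "C2 f \<longleftrightarrow>
     (\<forall>u. f field_differentiable at u) \<and> (\<forall>u. deriv f field_differentiable at u) \<and>
     continuous_on UNIV (deriv (deriv f))"

definition mollifier :: "(real \<Rightarrow> real) \<Rightarrow> bool" where
  "mollifier g \<longleftrightarrow>
     C2 g \<and> (\<forall>u. 0 \<le> g u) \<and>
     compact (closure {u. g u \<noteq> 0}) \<and> closure {u. g u \<noteq> 0} \<subseteq> {0..} \<and>
     (LINT u|lborel. g u) = 1"

definition scaled :: "(real \<Rightarrow> real) \<Rightarrow> nat \<Rightarrow> real \<Rightarrow> real" where
  "scaled g n u = real n * g (real n * u)"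

definition convolution :: "(real \<Rightarrow> real) \<Rightarrow> (real \<Rightarrow> real) \<Rightarrow> real \<Rightarrow> real" where
  "convolution g f u = (LINT y|lborel. g (u - y) * f y)"

definition left_deriv :: "(real \<Rightarrow> real) \<Rightarrow> real \<Rightarrow> real" where
  "left_deriv f u = Lim (at_left u) (\<lambda>v. (f v - f u) / (v - u))"

text \<open>Counterpart of \<^const>\<open>interval_measure\<close> for intervals \<open>[a, b)\<close>. For convex \<open>f\<close>,
  \<open>emeasure_second_deriv_measure\<close> below shows that the prescribed values are attained.\<close>

definition second_deriv_measure :: "(real \<Rightarrow> real) \<Rightarrow> real measure" where
  "second_deriv_measure f =
     extend_measure UNIV {(a, b). a \<le> b} (\<lambda>(a, b). {a..<b})
       (\<lambda>(a, b). ennreal (left_deriv f b - left_deriv f a))"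

lemma sets_second_deriv_measure [simp, measurable_cong]:
  "sets (second_deriv_measure f) = sets borel"
proof -
  have "(\<lambda>(a, b). {a..<b}) ` {(a, b). a \<le> b} = range (\<lambda>(a, b). {a..<b :: real})"
  proof (intro equalityI subsetI)
    fix A assume "A \<in> range (\<lambda>(a, b). {a..<b :: real})"
    then obtain a b where "A = {a..<b}" by auto
    then have "A = {a..<max a b}" by (auto simp: max_def)
    then show "A \<in> (\<lambda>(a, b). {a..<b}) ` {(a, b). a \<le> b}"
      by (intro image_eqI[of _ _ "(a, max a b)"]) auto
  qed auto
  then show ?thesis
    by (simp add: second_deriv_measure_def sets_extend_measure borel_eq_atLeastLessThan)
qed

lemma space_second_deriv_measure [simp]: "space (second_deriv_measure f) = UNIV"
  by (simp add: second_deriv_measure_def space_extend_measure)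

lemma convex_slope_mono:
  fixes f :: "real \<Rightarrow> real"
  assumes "convex_on UNIV f" "a < b" "b < c"
  shows "(f b - f a) / (b - a) \<le> (f c - f a) / (c - a)"
    and "(f c - f a) / (c - a) \<le> (f c - f b) / (c - b)"
  using convex_on_slope_le[of UNIV f a c b] assms
  by (auto simp: divide_simps mult.commute algebra_simps)

lemma convex_left_deriv:
  fixes f :: "real \<Rightarrow> real"
  assumes f: "convex_on UNIV f"
  shows "((\<lambda>v. (f v - f u) / (v - u)) \<longlongrightarrow> left_deriv f u) (at_left u)"
    and "v < u \<Longrightarrow> (f v - f u) / (v - u) \<le> left_deriv f u"
    and "u < v \<Longrightarrow> left_deriv f u \<le> (f v - f u) / (v - u)"
proof -
  define s where "s = (\<lambda>v. (f v - f u) / (v - u))"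
  have flip: "s v = (f u - f v) / (u - v)" for v
    by (simp add: s_def minus_divide_divide [symmetric, of "f v - f u"])
  have mono: "s v \<le> s w" if "v < w" "w < u" for v w
    using convex_slope_mono(2)[OF f that] by (simp add: flip)
  have bnd: "s v \<le> s w" if "v < u" "u < w" for v w
  proof -
    have "s v \<le> (f w - f u) / (w - u)"
      using convex_slope_mono[OF f that] unfolding flip by linarith
    then show ?thesis by (simp add: s_def)
  qed
  define S where "S = Sup (s ` {..<u})"
  have bdd: "bdd_above (s ` {..<u})"
    using bnd[of _ "u + 1"] by (auto intro!: bdd_aboveI[of _ "s (u + 1)"])
  have ub: "s v \<le> S" if "v < u" for v
    unfolding S_def using that bdd by (intro cSup_upper) auto
  have "(s \<longlongrightarrow> S) (at_left u)"
  proof (rule increasing_tendsto)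
    show "\<forall>\<^sub>F v in at_left u. s v \<le> S"
      using ub by (auto simp: eventually_at_filter)
    fix c assume "c < S"
    then obtain v where v: "v < u" "c < s v"
      unfolding S_def using less_cSup_iff[OF _ bdd] by auto
    have "\<forall>\<^sub>F w in at_left u. w \<in> {v<..<u}"
      using v(1) by (rule eventually_at_left_real)
    then show "\<forall>\<^sub>F w in at_left u. c < s w"
      by eventually_elim (use mono v in \<open>force intro: less_le_trans\<close>)
  qed
  moreover from this have "left_deriv f u = S"
    unfolding left_deriv_def s_def by (intro tendsto_Lim) auto
  ultimately show "((\<lambda>v. (f v - f u) / (v - u)) \<longlongrightarrow> left_deriv f u) (at_left u)"
    by (simp add: s_def)
  show "v < u \<Longrightarrow> (f v - f u) / (v - u) \<le> left_deriv f u"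
    using ub[of v] \<open>left_deriv f u = S\<close> by (simp add: s_def)
  show "u < v \<Longrightarrow> left_deriv f u \<le> (f v - f u) / (v - u)"
  proof -
    assume "u < v"
    then have "S \<le> s v"
      unfolding S_def using bnd by (intro cSup_least) auto
    then show ?thesis
      using \<open>left_deriv f u = S\<close> by (simp add: s_def)
  qed
qed

lemma convex_left_deriv_mono:
  fixes f :: "real \<Rightarrow> real"
  assumes f: "convex_on UNIV f" and "a \<le> b"
  shows "left_deriv f a \<le> left_deriv f b"
proof (cases "a = b")
  case False
  then have "a < b" using assms by simp
  have "left_deriv f a \<le> (f b - f a) / (b - a)"
    using convex_left_deriv(3)[OF f \<open>a < b\<close>] .
  also have "\<dots> = (f a - f b) / (a - b)"
    by (simp add: minus_divide_divide [symmetric, of "f a - f b"])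
  also have "\<dots> \<le> left_deriv f b"
    using convex_left_deriv(2)[OF f \<open>a < b\<close>] .
  finally show ?thesis .
qed simp

lemma convex_left_deriv_left_continuous:
  fixes f :: "real \<Rightarrow> real"
  assumes f: "convex_on UNIV f"
  shows "(left_deriv f \<longlongrightarrow> left_deriv f u) (at_left u)"
proof (rule increasing_tendsto)
  show "\<forall>\<^sub>F v in at_left u. left_deriv f v \<le> left_deriv f u"
    using convex_left_deriv_mono[OF f] by (auto simp: eventually_at_filter)
  fix c assume "c < left_deriv f u"
  then have "\<forall>\<^sub>F v in at_left u. c < (f v - f u) / (v - u)"
    using convex_left_deriv(1)[OF f] by (rule order_tendstoD(1)[rotated])
  moreover have "\<forall>\<^sub>F v in at_left u. v < u"
    by (auto simp: eventually_at_filter)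
  ultimately have "\<forall>\<^sub>F v in at_left u. c < (f v - f u) / (v - u) \<and> v < u"
    by eventually_elim simp
  then obtain v where v: "c < (f v - f u) / (v - u)" "v < u"
    using eventually_happens[of _ "at_left u"] by fastforce
  have "isCont f u"
    using convex_on_continuous[OF open_UNIV f] by (simp add: continuous_on_eq_continuous_at)
  then have "((\<lambda>w. (f v - f w) / (v - w)) \<longlongrightarrow> (f v - f u) / (v - u)) (at_left u)"
    using v(2) by (auto intro!: tendsto_intros simp: isCont_def filterlim_at_split)
  then have "\<forall>\<^sub>F w in at_left u. c < (f v - f w) / (v - w)"
    using v(1) by (rule order_tendstoD(1))
  moreover have "\<forall>\<^sub>F w in at_left u. w \<in> {v<..<u}"
    using v(2) by (rule eventually_at_left_real)
  ultimately show "\<forall>\<^sub>F w in at_left u. c < left_deriv f w"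
    by eventually_elim (use convex_left_deriv(2)[OF f] in \<open>force intro: less_le_trans\<close>)
qed

theorem emeasure_second_deriv_measure:
  fixes f :: "real \<Rightarrow> real"
  assumes f: "convex_on UNIV f" and ab: "a \<le> b"
  shows "emeasure (second_deriv_measure f) {a..<b} = ennreal (left_deriv f b - left_deriv f a)"
proof -
  define F where "F = (\<lambda>u. - left_deriv f (- u))"
  define M where "M = distr (interval_measure F) borel uminus"
  have mono: "F u \<le> F v" if "u \<le> v" for u v
    using convex_left_deriv_mono[OF f, of "- v" "- u"] that by (simp add: F_def)
  have cont: "continuous (at_right u) F" for u
  proof -
    have "((\<lambda>v. left_deriv f (- v)) \<longlongrightarrow> left_deriv f (- u)) (at_right u)"
      using convex_left_deriv_left_continuous[OF f, of "- u"]
      by (simp add: filterlim_at_left_to_right[of _ _ "- u"])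
    then show ?thesis
      by (auto simp: continuous_within F_def intro!: tendsto_intros)
  qed
  have val: "emeasure M {c..<d} = ennreal (left_deriv f d - left_deriv f c)" if "c \<le> d" for c d
  proof -
    have "uminus -` {c..<d} = {- d<..- c}" by auto
    then show ?thesis
      using emeasure_interval_measure_Ioc[of "- d" "- c" F] that mono cont
      by (simp add: M_def emeasure_distr F_def)
  qed
  have sets_M: "sets M = sets (second_deriv_measure f)"
    by (simp add: M_def)
  show ?thesis
  proof (rule emeasure_extend_measure_Pair[OF second_deriv_measure_def])
    show "positive (sets (second_deriv_measure f)) (emeasure M)"
      unfolding sets_M[symmetric] by (rule emeasure_positive)
    show "countably_additive (sets (second_deriv_measure f)) (emeasure M)"
      unfolding sets_M[symmetric] by (rule emeasure_countably_additive)
  qed (use val ab in auto)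
qed

end

theory Submission
  imports Defs
begin

text \<open>
  Suppose first that \<open>F\<close> is twice continuously differentiable. Taylor's formula with integral
  remainder on each partition step, written with \<open>half_open a b\<close>, is
  \[ F(b) - F(a) = F'(a)(b - a) + \int 1_{[[a,b))}(u)\, |b - u|\, F''(u)\, du. \]
  Summing over the steps gives an exact discrete formula, in which the remainders add up to half the
  integral of the discrete local time against \<open>F''\<close> (\<open>discrete_ito_formula\<close>). The discrete local
  times vanish off the compact range of the path, so \<open>F''\<close> may be cut off to a bounded function, and
  weak convergence in \<open>L\<^sup>1\<close> yields at once that the Foellmer integral of \<open>F'\<close> exists and what it is
  (\<open>follmer_sum_tendsto\<close>).

  For convex \<open>f\<close> this is applied to \<open>F = g\<^sub>n * f\<close>. As \<open>g\<^sub>n * f\<close> converges to \<open>f\<close> locally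
  uniformly, only the integral of \<open>L\<^sub>t\<close> against \<open>(g\<^sub>n * f)''\<close> needs care. Moving both derivatives
  to \<open>f\<close> gives \<open>(g\<^sub>n * f)''(u) = \<integral> g\<^sub>n(u - v) f''(dv)\<close> (\<open>second_deriv_convolution_convex\<close>), and by
  Fubini
  \[ \int L_t(u)\, (g_n * f)''(u)\, du = \int \Bigl( \int L_t(u)\, g_n(u - v)\, du \Bigr) f''(dv). \]
  Since \<open>g\<^sub>n\<close> has mass one and is supported in some \<open>[0, R / n]\<close>, the inner integral averages \<open>L\<^sub>t\<close>
  over a short interval to the right of \<open>v\<close>. Right-continuity therefore makes it converge to
  \<open>L\<^sub>t(v)\<close> at every \<open>v\<close>, including the atoms of \<open>f''\<close>, and dominated convergence
  finishes the argument. This is where the support of \<open>g\<close> in \<open>[0, \<infinity>)\<close> matters. The limit is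
  \<open>f(x\<^sub>t) - f(x\<^sub>0) - \<integral> L\<^sub>t df'' / 2\<close>, which does not involve \<open>g\<close>.

  Convergence at a fixed time and uniform convergence on a compact set of times have the same proof. A
  single cadlag function is a jointly cadlag family that is constant in time, so
  \<open>uniform_limit_follmer_integral\<close> covers both cases. A jointly cadlag family is right-continuous in
  space uniformly over compact sets of times, and uniform convergence is tested along sequences
  of times, so that dominated convergence is still available.
\<close>

section \<open>Convolution with smooth kernels\<close>

lemma continuous_compact_support_bounded:
  fixes k :: "real \<Rightarrow> real"
  assumes cont: "continuous_on UNIV k" and supp: "\<And>z. k z \<noteq> 0 \<Longrightarrow> z \<in> {a..b}"
  obtains C where "\<And>z. \<bar>k z\<bar> \<le> C" "0 \<le> C"
proof -
  have "bounded (k ` {a..b})"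
    using cont by (intro compact_imp_bounded compact_continuous_image)
      (auto intro: continuous_on_subset)
  then obtain C where "\<And>z. z \<in> {a..b} \<Longrightarrow> \<bar>k z\<bar> \<le> C"
    unfolding bounded_iff real_norm_def by blast
  then have "\<bar>k z\<bar> \<le> max C 0" for z
    using supp[of z] by (cases "k z = 0") (auto simp: le_max_iff_disj)
  then show ?thesis by (intro that) auto
qed

lemma integrable_kernel_mult:
  fixes k q :: "real \<Rightarrow> real"
  assumes cont: "continuous_on UNIV k" and supp: "\<And>z. k z \<noteq> 0 \<Longrightarrow> z \<in> {0..r}"
    and q [measurable]: "q \<in> borel_measurable borel" and bdd: "\<And>a b. bounded (q ` {a..b})"
  shows "integrable lborel (\<lambda>y. k (u - y) * q y)"
proof -
  have [measurable]: "k \<in> borel_measurable borel"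
    using cont by (rule borel_measurable_continuous_onI)
  obtain C where C: "\<And>z. \<bar>k z\<bar> \<le> C" "0 \<le> C"
    using continuous_compact_support_bounded[OF cont supp] by blast
  obtain D where D: "\<And>y. y \<in> {u - r..u} \<Longrightarrow> \<bar>q y\<bar> \<le> D"
    using bdd[of "u - r" u] unfolding bounded_iff real_norm_def by blast
  show ?thesis
  proof (rule integrableI_bounded_set[where A = "{u - r..u}" and B = "C * D"])
    show "AE y in lborel. y \<in> {u - r..u} \<longrightarrow> norm (k (u - y) * q y) \<le> C * D"
      using C D by (intro AE_I2) (auto simp: abs_mult intro!: mult_mono)
    show "AE y in lborel. y \<notin> {u - r..u} \<longrightarrow> k (u - y) * q y = 0"
      using supp by (intro AE_I2) force
  qed (auto simp: emeasure_lborel_Icc_eq)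
qed

text \<open>The derivative falls on the kernel, so \<open>q\<close> may be discontinuous. It will be applied with
  the left derivative of a convex function in the role of \<open>q\<close>. The difference quotients of
  \<open>k\<close> are bounded by the mean value theorem and live on a common compact set, hence dominated
  convergence applies.\<close>

lemma has_derivative_convolution:
  fixes k k' q :: "real \<Rightarrow> real"
  assumes der: "\<And>z. (k has_real_derivative k' z) (at z)" and cont: "continuous_on UNIV k'"
    and supp: "\<And>z. k z \<noteq> 0 \<Longrightarrow> z \<in> {0..r}" and supp': "\<And>z. k' z \<noteq> 0 \<Longrightarrow> z \<in> {0..r}"
    and q [measurable]: "q \<in> borel_measurable borel" and bdd: "\<And>a b. bounded (q ` {a..b})"
  shows "(convolution k q has_real_derivative convolution k' q u) (at u)"
  unfolding has_field_derivative_iff tendsto_at_iff_sequentially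
proof (intro allI impI)
  fix X assume X: "\<forall>i. X i \<in> UNIV - {u}" "X \<longlonglongrightarrow> u"
  have contk: "continuous_on UNIV k"
    using der DERIV_isCont continuous_at_imp_continuous_on by blast
  note [measurable] = borel_measurable_continuous_onI[OF cont]
    borel_measurable_continuous_onI[OF contk]
  obtain C where C: "\<And>z. \<bar>k' z\<bar> \<le> C" "0 \<le> C"
    using continuous_compact_support_bounded[OF cont supp'] by blast
  have lip: "\<bar>k a - k b\<bar> \<le> C * \<bar>a - b\<bar>" for a b
    using field_differentiable_bound[of UNIV k k' C a b] der C by auto
  obtain K where K: "\<And>i. \<bar>X i - u\<bar> \<le> K" "0 \<le> K"
  proof -
    have "Bseq (\<lambda>i. X i - u)"
      using X(2) by (intro convergent_imp_Bseq convergentI[of _ "u - u"] tendsto_intros)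
    then obtain K where "0 < K" "\<And>i. \<bar>X i - u\<bar> \<le> K"
      unfolding Bseq_def real_norm_def by blast
    then show ?thesis using that[of K] by simp
  qed
  define S where "S = {u - K - r..u + K}"
  obtain D where D: "\<And>y. y \<in> S \<Longrightarrow> \<bar>q y\<bar> \<le> D"
    using bdd[of "u - K - r" "u + K"] unfolding bounded_iff real_norm_def S_def by blast
  define s where "s i y = (k (X i - y) - k (u - y)) / (X i - u) * q y" for i y
  have "(\<lambda>i. LINT y|lborel. s i y) \<longlonglongrightarrow> (LINT y|lborel. k' (u - y) * q y)"
  proof (rule integral_dominated_convergence[where w = "\<lambda>y. C * D * indicator S y"])
    show "AE y in lborel. (\<lambda>i. s i y) \<longlonglongrightarrow> k' (u - y) * q y"
    proof (intro AE_I2)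
      fix y
      have "(\<lambda>i. X i - y) \<longlonglongrightarrow> u - y" "\<forall>i. X i - y \<in> UNIV - {u - y}"
        using X by (auto intro!: tendsto_intros)
      then have "(\<lambda>i. (k (X i - y) - k (u - y)) / ((X i - y) - (u - y))) \<longlonglongrightarrow> k' (u - y)"
        using der[of "u - y", unfolded has_field_derivative_iff tendsto_at_iff_sequentially,
            rule_format, of "\<lambda>i. X i - y"] by (simp add: o_def)
      then show "(\<lambda>i. s i y) \<longlonglongrightarrow> k' (u - y) * q y"
        unfolding s_def by (intro tendsto_intros) simp
    qed
    show "AE y in lborel. norm (s i y) \<le> C * D * indicator S y" for i
    proof (intro AE_I2)
      fix y
      show "norm (s i y) \<le> C * D * indicator S y"
      proof (cases "y \<in> S")
        case True
        have "\<bar>(k (X i - y) - k (u - y)) / (X i - u)\<bar> \<le> C"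
          using lip[of "X i - y" "u - y"] X(1) by (auto simp: abs_divide divide_le_eq)
        then have "\<bar>(k (X i - y) - k (u - y)) / (X i - u)\<bar> * \<bar>q y\<bar> \<le> C * D"
          using D[OF True] C(2) by (intro mult_mono) auto
        then show ?thesis
          using True by (simp add: s_def abs_mult)
      next
        case False
        then have "X i - y \<notin> {0..r}" "u - y \<notin> {0..r}"
          using K(1)[of i] K(2) by (auto simp: S_def abs_le_iff)
        then have "k (X i - y) = 0" "k (u - y) = 0"
          using supp by blast+
        then show ?thesis using False by (simp add: s_def)
      qed
    qed
  qed (auto simp: s_def S_def integrable_real_indicator emeasure_lborel_Icc_eq)
  moreover have "(LINT y|lborel. s i y) = (convolution k q (X i) - convolution k q u) / (X i - u)" for i
  proof -
    have "(LINT y|lborel. s i y) = (LINT y|lborel. (k (X i - y) * q y - k (u - y) * q y) / (X i - u))"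
      by (simp add: s_def algebra_simps)
    also have "\<dots> = (LINT y|lborel. k (X i - y) * q y - k (u - y) * q y) / (X i - u)"
      by simp
    finally show ?thesis
      using integrable_kernel_mult[OF contk supp q bdd]
      by (simp add: convolution_def)
  qed
  ultimately show "((\<lambda>y. (convolution k q y - convolution k q u) / (y - u)) \<circ> X)
      \<longlonglongrightarrow> convolution k' q u"
    by (simp add: o_def convolution_def)
qed

text \<open>Everything used about a scaled mollifier \<open>g\<^sub>n\<close>: the radius \<open>r\<close> is \<open>R / n\<close> when \<open>g\<close> is
  supported in \<open>[0, R]\<close>.\<close>

locale smooth_kernel =
  fixes k :: "real \<Rightarrow> real" and r :: real
  assumes C2: "C2 k" and nonneg: "0 \<le> k z" and supp: "k z \<noteq> 0 \<Longrightarrow> z \<in> {0..r}"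
    and mass: "(LINT z|lborel. k z) = 1"
begin

lemma deriv1: "(k has_real_derivative deriv k z) (at z)"
  using C2 by (auto simp: C2_def DERIV_deriv_iff_field_differentiable)

lemma deriv2: "(deriv k has_real_derivative deriv (deriv k) z) (at z)"
  using C2 by (auto simp: C2_def DERIV_deriv_iff_field_differentiable)

lemma cont: "continuous_on UNIV k"
  using deriv1 DERIV_isCont continuous_at_imp_continuous_on by blast

lemma cont': "continuous_on UNIV (deriv k)"
  using deriv2 DERIV_isCont continuous_at_imp_continuous_on by blast

lemma supp': "deriv k z \<noteq> 0 \<Longrightarrow> z \<in> {0..r}"
proof (rule ccontr)
  assume "deriv k z \<noteq> 0" "z \<notin> {0..r}"
  have "\<forall>\<^sub>F w in nhds z. w \<in> - {0..r}"
    using \<open>z \<notin> {0..r}\<close> by (intro eventually_nhds_in_open) (auto intro: open_Compl)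
  then have "\<forall>\<^sub>F w in nhds z. k w = 0"
    by eventually_elim (use supp in auto)
  then have "deriv k z = deriv (\<lambda>w. 0) z" by (intro deriv_cong_ev) auto
  then show False using \<open>deriv k z \<noteq> 0\<close> by simp
qed

lemma supp'': "deriv (deriv k) z \<noteq> 0 \<Longrightarrow> z \<in> {0..r}"
proof (rule ccontr)
  assume "deriv (deriv k) z \<noteq> 0" "z \<notin> {0..r}"
  have "\<forall>\<^sub>F w in nhds z. w \<in> - {0..r}"
    using \<open>z \<notin> {0..r}\<close> by (intro eventually_nhds_in_open) (auto intro: open_Compl)
  then have "\<forall>\<^sub>F w in nhds z. deriv k w = 0"
    by eventually_elim (use supp' in auto)
  then have "deriv (deriv k) z = deriv (\<lambda>w. 0) z" by (intro deriv_cong_ev) auto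
  then show False using \<open>deriv (deriv k) z \<noteq> 0\<close> by simp
qed

lemma measurable_kernel [measurable]:
  "k \<in> borel_measurable borel" "deriv k \<in> borel_measurable borel"
  using cont cont' by (auto intro: borel_measurable_continuous_onI)

lemma mass_reflected: "(LINT y|lborel. k (u - y)) = 1"
  using lborel_integral_real_affine[of "-1" k u] mass by simp

lemma mass_shifted: "(LINT u|lborel. k (u - v)) = 1"
  using lborel_integral_real_affine[of 1 k "- v"] mass by simp

lemma integrable_reflected: "integrable lborel (\<lambda>y. k (u - y))"
  using mass_reflected not_integrable_integral_eq by fastforce

lemma integrable_shifted: "integrable lborel (\<lambda>u. k (u - v))"
  using mass_shifted not_integrable_integral_eq by fastforce

text \<open>The kernel is a probability density, so the convolution at \<open>u\<close> is an average of \<open>q\<close> over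
  the interval of length \<open>r\<close> to the left of \<open>u\<close>.\<close>

lemma average_close:
  assumes q [measurable]: "q \<in> borel_measurable borel"
    and int: "integrable lborel (\<lambda>y. k (u - y) * q y)"
    and close: "\<And>y. y \<in> {u - r..u} \<Longrightarrow> \<bar>q y - c\<bar> \<le> e"
  shows "\<bar>convolution k q u - c\<bar> \<le> e"
proof -
  have "convolution k q u - c = (LINT y|lborel. k (u - y) * q y) - (LINT y|lborel. k (u - y) * c)"
    using integrable_reflected mass_reflected by (simp add: convolution_def)
  also have "\<dots> = (LINT y|lborel. k (u - y) * (q y - c))"
    using int integrable_reflected
    by (subst Bochner_Integration.integral_diff[symmetric]) (auto simp: algebra_simps)
  finally have "\<bar>convolution k q u - c\<bar> = \<bar>LINT y|lborel. k (u - y) * (q y - c)\<bar>"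
    by simp
  also have "\<dots> \<le> (LINT y|lborel. \<bar>k (u - y) * (q y - c)\<bar>)"
    by (rule integral_abs_bound)
  also have "\<dots> \<le> (LINT y|lborel. k (u - y) * e)"
  proof (rule integral_mono)
    fix y
    show "\<bar>k (u - y) * (q y - c)\<bar> \<le> k (u - y) * e"
      using supp[of "u - y"] nonneg[of "u - y"] close[of y]
      by (cases "k (u - y) = 0") (auto simp: abs_mult intro!: mult_left_mono)
    show "integrable lborel (\<lambda>y. \<bar>k (u - y) * (q y - c)\<bar>)"
      using int integrable_reflected by (simp add: right_diff_distrib)
  qed (use integrable_reflected in auto)
  also have "\<dots> = e" using mass_reflected integrable_reflected by simp
  finally show ?thesis .
qed

end

text \<open>The reflected situation, with the average taken to the right of \<open>v\<close>. It is what Fubini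
  leaves for the local time, and the one-sided interval matches its right-continuity.\<close>

lemma (in smooth_kernel) average_close_shifted:
  assumes q [measurable]: "q \<in> borel_measurable borel"
    and int: "integrable lborel (\<lambda>u. q u * k (u - v))"
    and close: "\<And>u. u \<in> {v..v + r} \<Longrightarrow> \<bar>q u - c\<bar> \<le> e"
  shows "\<bar>(LINT u|lborel. q u * k (u - v)) - c\<bar> \<le> e"
proof -
  have eq: "(LINT u|lborel. q u * k (u - v)) = convolution k (\<lambda>y. q (- y)) (- v)"
    using lborel_integral_real_affine[of "-1" "\<lambda>u. q u * k (u - v)" 0]
    by (simp add: convolution_def algebra_simps minus_diff_commute)
  show ?thesis
    unfolding eq
  proof (rule average_close)
    show "integrable lborel (\<lambda>y. k (- v - y) * q (- y))"
      using lborel_integrable_real_affine[OF int, of "-1" 0] by (simp add: algebra_simps minus_diff_commute)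
    show "\<bar>q (- y) - c\<bar> \<le> e" if "y \<in> {- v - r..- v}" for y
      using that by (intro close) auto
  qed measurable
qed

lemma mollifier_smooth_kernel:
  assumes g: "mollifier g"
  obtains R where "\<And>n. 1 \<le> n \<Longrightarrow> smooth_kernel (scaled g n) (R / real n)"
proof -
  define S where "S = closure {u. g u \<noteq> 0}"
  have S: "compact S" "S \<subseteq> {0..}"
    using g by (simp_all add: mollifier_def S_def)
  obtain R where R: "\<And>u. u \<in> S \<Longrightarrow> \<bar>u\<bar> \<le> R"
    using compact_imp_bounded[OF S(1)] unfolding bounded_iff real_norm_def by blast
  have pos: "\<And>u. u \<in> S \<Longrightarrow> 0 \<le> u"
    using S(2) by auto
  have C2: "C2 g" using g by (simp add: mollifier_def)
  have "smooth_kernel (scaled g n) (R / real n)" if "1 \<le> n" for n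
  proof
    have n: "0 < real n" using that by simp
    have d1: "(scaled g n has_real_derivative (real n)\<^sup>2 * deriv g (real n * u)) (at u)" for u
      unfolding scaled_def using C2
      by (auto simp: C2_def DERIV_deriv_iff_field_differentiable[symmetric] power2_eq_square
          intro!: derivative_eq_intros DERIV_chain2[of g])
    have D1: "deriv (scaled g n) = (\<lambda>u. (real n)\<^sup>2 * deriv g (real n * u))"
      using d1 by (auto intro: DERIV_imp_deriv)
    have d2: "(deriv (scaled g n) has_real_derivative (real n)^3 * deriv (deriv g) (real n * u)) (at u)" for u
      unfolding D1 using C2
      by (auto simp: C2_def DERIV_deriv_iff_field_differentiable[symmetric] power2_eq_square
          power3_eq_cube intro!: derivative_eq_intros DERIV_chain2[of "deriv g"])
    have D2: "deriv (deriv (scaled g n)) = (\<lambda>u. (real n)^3 * deriv (deriv g) (real n * u))"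
      using d2 by (auto intro: DERIV_imp_deriv)
    show "C2 (scaled g n)"
      unfolding C2_def
    proof (intro conjI allI)
      show "scaled g n field_differentiable at u" "deriv (scaled g n) field_differentiable at u" for u
        using d1 d2 by (auto simp: field_differentiable_def)
      show "continuous_on UNIV (deriv (deriv (scaled g n)))"
        unfolding D2 using C2
        by (intro continuous_on_mult_left
            continuous_on_compose2[of UNIV "deriv (deriv g)" UNIV "\<lambda>u. real n * u"])
          (auto simp: C2_def)
    qed
    show "0 \<le> scaled g n z" for z using g by (auto simp: scaled_def mollifier_def)
    show "z \<in> {0..R / real n}" if "scaled g n z \<noteq> 0" for z
    proof -
      have "real n * z \<in> S"
        using that closure_subset[of "{u. g u \<noteq> 0}"] by (auto simp: scaled_def S_def)
      then show ?thesis
        using R[of "real n * z"] pos[of "real n * z"] n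
        by (auto simp: zero_le_mult_iff le_divide_eq mult.commute)
    qed
    show "(LINT z|lborel. scaled g n z) = 1"
      using lborel_integral_real_affine[of "real n" g 0] g n
      by (simp add: scaled_def mollifier_def)
  qed
  then show ?thesis by (rule that)
qed

section \<open>Mollified convex functions\<close>

lemma convex_left_deriv_slope:
  fixes f :: "real \<Rightarrow> real"
  assumes f: "convex_on UNIV f" and uv: "u < v"
  shows "left_deriv f u \<le> (f v - f u) / (v - u)" "(f v - f u) / (v - u) \<le> left_deriv f v"
  using convex_left_deriv(3)[OF f uv] convex_left_deriv(2)[OF f uv]
  by (simp_all add: minus_divide_divide [symmetric, of "f v - f u"])

context
  fixes f :: "real \<Rightarrow> real"
  assumes f: "convex_on UNIV f"
begin

lemma continuous_on_convex: "continuous_on UNIV f"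
  using convex_on_continuous[OF open_UNIV f] .

lemma measurable_convex: "f \<in> borel_measurable borel"
  using continuous_on_convex by (rule borel_measurable_continuous_onI)

lemma bounded_convex: "bounded (f ` {a..b})"
  using continuous_on_convex
  by (intro compact_imp_bounded compact_continuous_image) (auto intro: continuous_on_subset)

lemma measurable_left_deriv: "left_deriv f \<in> borel_measurable borel"
  using convex_left_deriv_mono[OF f] by (intro borel_measurable_mono monoI)

lemma bounded_left_deriv: "bounded (left_deriv f ` {a..b})"
proof -
  have "left_deriv f ` {a..b} \<subseteq> {left_deriv f a..left_deriv f b}"
    using convex_left_deriv_mono[OF f] by auto
  then show ?thesis using bounded_closed_interval bounded_subset by blast
qed

text \<open>One derivative moves from the kernel to \<open>f\<close>. The derivative exists by
  \<open>has_derivative_convolution\<close>, so it can be computed from left difference quotients alone. After a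
  translation these fall on \<open>f\<close>, where they converge to the left derivative at every point
  and are trapped between two values of the monotone left derivative.\<close>

lemma has_derivative_convolution_convex:
  assumes "smooth_kernel k r"
  shows "(convolution k f has_real_derivative convolution k (left_deriv f) u) (at u)"
proof -
  note [measurable] = measurable_convex measurable_left_deriv
  interpret smooth_kernel k r by fact
  let ?q = "left_deriv f"
  define h where "h i = 1 / real (Suc i)" for i
  have h: "0 < h i" "h i \<le> 1" for i by (auto simp: h_def divide_le_eq)
  have h0: "h \<longlonglongrightarrow> 0" unfolding h_def by (rule LIMSEQ_Suc[OF lim_1_over_n])
  have der: "(convolution k f has_real_derivative convolution (deriv k) f u) (at u)" for u
    using has_derivative_convolution[OF deriv1 cont' supp supp' measurable_convex bounded_convex] .
  define s where "s i y = k (u - y) * ((f y - f (y - h i)) / h i)" for i y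
  obtain C where C: "\<And>z. \<bar>k z\<bar> \<le> C" "0 \<le> C"
    using continuous_compact_support_bounded[OF cont supp] by blast
  define D where "D = max \<bar>?q (u - r - 1)\<bar> \<bar>?q u\<bar>"
  have "(\<lambda>i. LINT y|lborel. s i y) \<longlonglongrightarrow> (LINT y|lborel. k (u - y) * ?q y)"
  proof (rule integral_dominated_convergence[where w = "\<lambda>y. C * D * indicator {u - r..u} y"])
    show "AE y in lborel. (\<lambda>i. s i y) \<longlonglongrightarrow> k (u - y) * ?q y"
    proof (intro AE_I2)
      fix y
      have "(\<lambda>i. y - h i) \<longlonglongrightarrow> y" using tendsto_diff[OF tendsto_const h0, of y] by simp
      moreover have "\<forall>i. y - h i \<in> {..<y} - {y}" using h by auto
      ultimately have "(\<lambda>i. (f (y - h i) - f y) / ((y - h i) - y)) \<longlonglongrightarrow> ?q y"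
        using convex_left_deriv(1)[OF f, of y, unfolded tendsto_at_iff_sequentially,
            rule_format, of "\<lambda>i. y - h i"] by (simp add: o_def)
      moreover have "(f (y - h i) - f y) / ((y - h i) - y) = (f y - f (y - h i)) / h i" for i
        using h(1)[of i] by (simp add: field_simps)
      ultimately show "(\<lambda>i. s i y) \<longlonglongrightarrow> k (u - y) * ?q y"
        unfolding s_def by (intro tendsto_intros) simp
    qed
    show "AE y in lborel. norm (s i y) \<le> C * D * indicator {u - r..u} y" for i
    proof (intro AE_I2)
      fix y
      show "norm (s i y) \<le> C * D * indicator {u - r..u} y"
      proof (cases "y \<in> {u - r..u}")
        case True
        have "?q (u - r - 1) \<le> ?q (y - h i)" "?q y \<le> ?q u"
          using True h[of i] by (auto intro!: convex_left_deriv_mono[OF f])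
        moreover have "?q (y - h i) \<le> (f y - f (y - h i)) / h i" "(f y - f (y - h i)) / h i \<le> ?q y"
          using convex_left_deriv_slope[OF f, of "y - h i" y] h[of i] by auto
        ultimately have "\<bar>(f y - f (y - h i)) / h i\<bar> \<le> D"
          unfolding D_def by linarith
        then have "\<bar>k (u - y)\<bar> * \<bar>(f y - f (y - h i)) / h i\<bar> \<le> C * D"
          using C by (intro mult_mono) auto
        then show ?thesis using True by (simp add: s_def abs_mult)
      next
        case False
        then have "u - y \<notin> {0..r}" by auto
        then have "k (u - y) = 0" using supp by blast
        then show ?thesis using False by (simp add: s_def)
      qed
    qed
  qed (auto simp: s_def integrable_real_indicator emeasure_lborel_Icc_eq)
  moreover have "(LINT y|lborel. s i y) = (convolution k f (u - h i) - convolution k f u) / (- h i)" for i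
  proof -
    have int: "integrable lborel (\<lambda>y. k (v - y) * f y)" for v
      by (rule integrable_kernel_mult[OF cont supp measurable_convex bounded_convex])
    have shift: "convolution k f (u - h i) = (LINT y|lborel. k (u - y) * f (y - h i))"
      using lborel_integral_real_affine[of 1 "\<lambda>y. k (u - h i - y) * f y" "- h i"]
      by (simp add: convolution_def algebra_simps)
    have int': "integrable lborel (\<lambda>y. k (u - y) * f (y - h i))"
      using lborel_integrable_real_affine[OF int[of "u - h i"], of 1 "- h i"]
      by (simp add: algebra_simps)
    have "(LINT y|lborel. s i y) = (LINT y|lborel. (k (u - y) * f y - k (u - y) * f (y - h i)) / h i)"
      by (simp add: s_def algebra_simps)
    also have "\<dots> = (convolution k f u - convolution k f (u - h i)) / h i"
      using int int' unfolding shift by (simp add: convolution_def)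
    finally show ?thesis
      using h(1)[of i] by (simp add: field_simps)
  qed
  moreover have "(\<lambda>i. (convolution k f (u - h i) - convolution k f u) / (- h i))
      \<longlonglongrightarrow> convolution (deriv k) f u"
  proof -
    have "(\<lambda>i. u - h i) \<longlonglongrightarrow> u" using tendsto_diff[OF tendsto_const h0, of u] by simp
    then show ?thesis
      using der[of u, unfolded has_field_derivative_iff tendsto_at_iff_sequentially,
          rule_format, of "\<lambda>i. u - h i"] h(1) by (simp add: o_def less_imp_neq[symmetric])
  qed
  ultimately have "convolution (deriv k) f u = convolution k ?q u"
    unfolding convolution_def by (intro LIMSEQ_unique) auto
  then show ?thesis using der by metis
qed

lemma deriv_convolution_convex:
  assumes "smooth_kernel k r"
  shows "deriv (convolution k f) = convolution k (left_deriv f)"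
  using has_derivative_convolution_convex[OF assms] by (auto intro: DERIV_imp_deriv)

lemma has_derivative2_convolution_convex:
  assumes "smooth_kernel k r"
  shows "(deriv (convolution k f) has_real_derivative convolution (deriv k) (left_deriv f) u) (at u)"
proof -
  interpret smooth_kernel k r by fact
  show ?thesis unfolding deriv_convolution_convex[OF assms]
    using has_derivative_convolution[OF deriv1 cont' supp supp' measurable_left_deriv bounded_left_deriv] .
qed

lemma deriv2_convolution_convex:
  assumes "smooth_kernel k r"
  shows "deriv (deriv (convolution k f)) = convolution (deriv k) (left_deriv f)"
  using has_derivative2_convolution_convex[OF assms] by (auto intro: DERIV_imp_deriv)

lemma continuous_deriv2_convolution_convex:
  assumes "smooth_kernel k r"
  shows "continuous_on UNIV (convolution (deriv k) (left_deriv f))"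
proof -
  interpret smooth_kernel k r by fact
  have "continuous_on UNIV (deriv (deriv k))" using C2 by (simp add: C2_def)
  then have "(convolution (deriv k) (left_deriv f) has_real_derivative
      convolution (deriv (deriv k)) (left_deriv f) u) (at u)" for u
    using has_derivative_convolution[OF deriv2 _ supp' supp'' measurable_left_deriv bounded_left_deriv]
    by blast
  then show ?thesis
    using DERIV_isCont continuous_at_imp_continuous_on by blast
qed

lemma C2_convolution_convex:
  assumes "smooth_kernel k r"
  shows "C2 (convolution k f)"
  using has_derivative_convolution_convex[OF assms] has_derivative2_convolution_convex[OF assms]
    continuous_deriv2_convolution_convex[OF assms]
  unfolding C2_def deriv2_convolution_convex[OF assms] by (auto simp: field_differentiable_def)

lemma emeasure_second_deriv_interval_finite: "emeasure (second_deriv_measure f) {a..b} < \<infinity>"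
proof (cases "a \<le> b")
  case True
  have "emeasure (second_deriv_measure f) {a..b} \<le> emeasure (second_deriv_measure f) {a..<b + 1}"
    by (intro emeasure_mono) auto
  also have "\<dots> < \<infinity>"
    using True by (subst emeasure_second_deriv_measure[OF f]) auto
  finally show ?thesis .
qed simp

lemma sigma_finite_second_deriv_measure: "sigma_finite_measure (second_deriv_measure f)"
proof
  let ?A = "range (\<lambda>n. {- real n..real n})"
  have "\<exists>n. - real n \<le> v \<and> v \<le> real n" for v
    using real_arch_simple[of "\<bar>v\<bar>"] by (auto simp: abs_le_iff minus_le_iff)
  then have "\<Union>?A = space (second_deriv_measure f)" by auto
  then show "\<exists>A. countable A \<and> A \<subseteq> sets (second_deriv_measure f) \<and>
      \<Union>A = space (second_deriv_measure f) \<and> (\<forall>a\<in>A. emeasure (second_deriv_measure f) a \<noteq> \<infinity>)"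
    using emeasure_second_deriv_interval_finite
    by (intro exI[of _ ?A]) (auto simp: less_top)
qed

lemma pair_sigma_finite_second_deriv: "pair_sigma_finite lborel (second_deriv_measure f)"
  using sigma_finite_second_deriv_measure by (simp add: pair_sigma_finite_def sigma_finite_lborel)

lemma integrable_pair_second_deriv:
  fixes H :: "real \<times> real \<Rightarrow> real"
  assumes H [measurable]: "H \<in> borel_measurable (lborel \<Otimes>\<^sub>M second_deriv_measure f)"
    and bdd: "\<And>p. \<bar>H p\<bar> \<le> C" and supp: "\<And>p. H p \<noteq> 0 \<Longrightarrow> p \<in> {a..b} \<times> {c..d}"
  shows "integrable (lborel \<Otimes>\<^sub>M second_deriv_measure f) H"
proof (rule integrableI_bounded_set[where A = "{a..b} \<times> {c..d}" and B = C])
  interpret sigma_finite_measure "second_deriv_measure f"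
    by (rule sigma_finite_second_deriv_measure)
  show "emeasure (lborel \<Otimes>\<^sub>M second_deriv_measure f) ({a..b} \<times> {c..d}) < \<infinity>"
    using emeasure_second_deriv_interval_finite[of c d]
    by (subst emeasure_pair_measure_Times) (auto simp: ennreal_mult_less_top emeasure_lborel_Icc_eq)
  show "{a..b} \<times> {c..d} \<in> sets (lborel \<Otimes>\<^sub>M second_deriv_measure f)"
    by (intro pair_measureI) auto
qed (use bdd supp in auto)

text \<open>The second derivative moves to \<open>f\<close> as well. To the right of a base point \<open>A\<close>, the left derivative is a constant plus the mass that \<open>f''\<close> gives to \<open>[A, y)\<close>. The
  constant is annihilated because \<open>k'\<close> has integral zero, and Fubini turns the rest into
  integrals of \<open>k'\<close> over half-lines, which are values of \<open>k\<close>.\<close>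

lemma second_deriv_convolution_convex:
  assumes "smooth_kernel k r"
  shows "convolution (deriv k) (left_deriv f) u = (LINT v|second_deriv_measure f. k (u - v))"
proof -
  note [measurable] = measurable_convex measurable_left_deriv
  interpret smooth_kernel k r by fact
  interpret pair_sigma_finite lborel "second_deriv_measure f"
    by (rule pair_sigma_finite_second_deriv)
  let ?q = "left_deriv f"
  let ?\<mu> = "second_deriv_measure f"
  (* Any base point strictly to the left of the support of y \<mapsto> k (u - y) would do. *)
  define A where "A = u - r - 1"
  have primitive: "(LINT y|lborel. deriv k (u - y) * indicator {v<..} y) = k (u - v)" for v
  proof (cases "v \<le> u + 1")
    case True
    have "(LINT y|lborel. deriv k (u - y) * indicator {v<..} y)
        = (LINT y|lborel. deriv k (u - y) * indicator {v..u + 1} y)"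
    proof (rule integral_cong_AE)
      show "AE y in lborel. deriv k (u - y) * indicator {v<..} y = deriv k (u - y) * indicator {v..u + 1} y"
        using AE_lborel_singleton[of v]
        by eventually_elim (use supp' in \<open>force simp: indicator_def\<close>)
    qed auto
    also have "\<dots> = - k (u - (u + 1)) - (- k (u - v))"
    proof (rule integral_FTC_Icc_real[OF True])
      show "((\<lambda>y. - k (u - y)) has_real_derivative deriv k (u - y)) (at y)" for y
        by (auto intro!: derivative_eq_intros DERIV_chain2[OF deriv1])
      show "isCont (\<lambda>y. deriv k (u - y)) y" for y
        by (rule isCont_o2[OF _ DERIV_isCont[OF deriv2]]) simp
    qed
    also have "k (u - (u + 1)) = 0" using supp[of "u - (u + 1)"] by auto
    finally show ?thesis by simp
  next
    case False
    then have "(\<lambda>y. deriv k (u - y) * indicator {v<..} y) = (\<lambda>_. 0)"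
      using supp'[of "u - y" for y] by (force simp: fun_eq_iff)
    moreover have "k (u - v) = 0" using supp[of "u - v"] False by auto
    ultimately show ?thesis by simp
  qed
  have zero: "(LINT y|lborel. deriv k (u - y)) = 0"
  proof -
    have "(\<lambda>y. deriv k (u - y) * indicator {A<..} y) = (\<lambda>y. deriv k (u - y))"
      using supp'[of "u - y" for y] by (force simp: fun_eq_iff A_def indicator_def)
    then have "(LINT y|lborel. deriv k (u - y)) = k (u - A)"
      using primitive[of A] by simp
    then show ?thesis using supp[of "u - A"] by (auto simp: A_def)
  qed
  have int1: "integrable lborel (\<lambda>y. deriv k (u - y))"
    using integrable_kernel_mult[OF cont' supp', of "\<lambda>_. 1" u] by (simp add: image_constant_conv)
  have int2: "integrable lborel (\<lambda>y. deriv k (u - y) * ?q y)"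
    by (rule integrable_kernel_mult[OF cont' supp' measurable_left_deriv bounded_left_deriv])
  obtain C where C: "\<And>z. \<bar>deriv k z\<bar> \<le> C" "0 \<le> C"
    using continuous_compact_support_bounded[OF cont' supp'] by blast
  define H where "H = (\<lambda>y v. deriv k (u - y) * indicator {A..} v * indicator {v<..} y)"
  have Hmeas: "case_prod H \<in> borel_measurable (lborel \<Otimes>\<^sub>M ?\<mu>)"
  proof -
    have "case_prod H = (\<lambda>p. deriv k (u - fst p) * indicator {A..} (snd p) * indicator {p. snd p < fst p} p)"
      by (auto simp: H_def fun_eq_iff indicator_def)
    then show ?thesis by simp
  qed
  have Hint: "integrable (lborel \<Otimes>\<^sub>M ?\<mu>) (case_prod H)"
  proof (rule integrable_pair_second_deriv[OF Hmeas])
    show "\<bar>case_prod H p\<bar> \<le> C" for p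
      using C by (auto simp: H_def indicator_def split: prod.split)
    show "p \<in> {u - r..u} \<times> {A..u}" if "case_prod H p \<noteq> 0" for p
      using that supp'[of "u - fst p"] by (auto simp: H_def indicator_def split: if_splits prod.splits)
  qed
  have "convolution (deriv k) ?q u = (LINT y|lborel. deriv k (u - y) * ?q y) - (LINT y|lborel. deriv k (u - y) * ?q A)"
    using zero by (simp add: convolution_def)
  also have "\<dots> = (LINT y|lborel. deriv k (u - y) * (?q y - ?q A))"
    using int1 int2
    by (subst Bochner_Integration.integral_diff[symmetric]) (auto simp: algebra_simps)
  also have "\<dots> = (LINT y|lborel. LINT v|?\<mu>. H y v)"
  proof (rule Bochner_Integration.integral_cong[OF refl])
    fix y
    show "deriv k (u - y) * (?q y - ?q A) = (LINT v|?\<mu>. H y v)"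
    proof (cases "deriv k (u - y) = 0")
      case False
      then have "A \<le> y" using supp'[of "u - y"] by (auto simp: A_def)
      have "H y v = deriv k (u - y) * indicator {A..<y} v" for v
        by (auto simp: H_def indicator_def)
      then have "(LINT v|?\<mu>. H y v) = deriv k (u - y) * measure ?\<mu> {A..<y}"
        by simp
      also have "measure ?\<mu> {A..<y} = ?q y - ?q A"
        using emeasure_second_deriv_measure[OF f \<open>A \<le> y\<close>] convex_left_deriv_mono[OF f \<open>A \<le> y\<close>]
        by (simp add: measure_def)
      finally show ?thesis by simp
    qed (simp add: H_def)
  qed
  also have "\<dots> = (LINT v|?\<mu>. LINT y|lborel. H y v)"
    using Fubini_integral[OF Hint] by simp
  also have "\<dots> = (LINT v|?\<mu>. k (u - v))"
  proof (rule Bochner_Integration.integral_cong[OF refl])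
    fix v
    have "(LINT y|lborel. H y v) = (LINT y|lborel. deriv k (u - y) * indicator {v<..} y) * indicator {A..} v"
      by (simp add: H_def mult.commute mult.left_commute flip: integral_mult_right_zero)
    also have "\<dots> = k (u - v)"
      using supp[of "u - v"] unfolding primitive by (cases "k (u - v) = 0") (auto simp: A_def)
    finally show "(LINT y|lborel. H y v) = k (u - v)" .
  qed
  finally show ?thesis .
qed

lemma integral_mult_second_deriv_convolution:
  assumes kernel: "smooth_kernel k r"
    and M [measurable]: "M \<in> borel_measurable borel"
    and bdd: "\<And>u. \<bar>M u\<bar> \<le> C" and suppM: "\<And>u. M u \<noteq> 0 \<Longrightarrow> u \<in> {a..b}"
  shows "integrable (second_deriv_measure f) (\<lambda>v. LINT u|lborel. M u * k (u - v))"
    and "(LINT u|lborel. M u * convolution (deriv k) (left_deriv f) u) =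
      (LINT v|second_deriv_measure f. LINT u|lborel. M u * k (u - v))"
proof -
  interpret smooth_kernel k r by fact
  interpret pair_sigma_finite lborel "second_deriv_measure f"
    by (rule pair_sigma_finite_second_deriv)
  let ?\<mu> = "second_deriv_measure f"
  obtain D where D: "\<And>z. \<bar>k z\<bar> \<le> D" "0 \<le> D"
    using continuous_compact_support_bounded[OF cont supp] by blast
  have "0 \<le> C" using bdd[of 0] by simp
  have int: "integrable (lborel \<Otimes>\<^sub>M ?\<mu>) (\<lambda>(u, v). M u * k (u - v))"
  proof (rule integrable_pair_second_deriv)
    show "\<bar>case_prod (\<lambda>u v. M u * k (u - v)) p\<bar> \<le> C * D" for p
      using bdd D \<open>0 \<le> C\<close> by (auto simp: abs_mult split: prod.split intro!: mult_mono)
    show "p \<in> {a..b} \<times> {a - r..b}" if "case_prod (\<lambda>u v. M u * k (u - v)) p \<noteq> 0" for p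
      using that suppM[of "fst p"] supp[of "fst p - snd p"] by (auto split: prod.splits)
  qed measurable
  show "integrable ?\<mu> (\<lambda>v. LINT u|lborel. M u * k (u - v))"
    using integrable_snd[OF int] .
  show "(LINT u|lborel. M u * convolution (deriv k) (left_deriv f) u) =
      (LINT v|?\<mu>. LINT u|lborel. M u * k (u - v))"
    unfolding second_deriv_convolution_convex[OF kernel] Fubini_integral[OF int] by simp
qed

lemma integrable_second_deriv:
  fixes M :: "real \<Rightarrow> real"
  assumes M: "M \<in> borel_measurable borel"
    and bdd: "\<And>u. \<bar>M u\<bar> \<le> C" and suppM: "\<And>u. M u \<noteq> 0 \<Longrightarrow> u \<in> {a..b}"
  shows "integrable (second_deriv_measure f) M"
proof (rule integrableI_bounded_set[where A = "{a..b}" and B = C])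
  show "emeasure (second_deriv_measure f) {a..b} < \<infinity>"
    by (rule emeasure_second_deriv_interval_finite)
  show "AE u in second_deriv_measure f. u \<in> {a..b} \<longrightarrow> norm (M u) \<le> C"
    using bdd by simp
  show "AE u in second_deriv_measure f. u \<notin> {a..b} \<longrightarrow> M u = 0"
    using suppM by blast
qed (use M in simp_all)

text \<open>Each \<open>M n\<close> is compared with its own integral, so right-continuity uniform in \<open>n\<close> takes
  the place of convergence of \<open>M\<close>. This freedom makes uniformity in time accessible: \<open>M n\<close> will be the local time at a time that depends on
  \<open>n\<close>.\<close>

lemma mollified_second_deriv_tendsto:
  fixes M :: "nat \<Rightarrow> real \<Rightarrow> real"
  assumes kernel: "\<And>n. smooth_kernel (\<kappa> n) (\<rho> n)" and \<rho>: "\<rho> \<longlonglongrightarrow> 0" "\<And>n. \<rho> n \<le> R"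
    and M [measurable]: "\<And>n. M n \<in> borel_measurable borel"
    and bdd: "\<And>n u. \<bar>M n u\<bar> \<le> C" and suppM: "\<And>n u. M n u \<noteq> 0 \<Longrightarrow> u \<in> {a..b}"
    and right: "\<And>v e. 0 < e \<Longrightarrow> \<exists>d>0. \<forall>n. \<forall>u\<in>{v..<v + d}. \<bar>M n u - M n v\<bar> \<le> e"
  shows "(\<lambda>n. (LINT u|lborel. M n u * convolution (deriv (\<kappa> n)) (left_deriv f) u) -
      (LINT u|second_deriv_measure f. M n u)) \<longlonglongrightarrow> 0"
proof -
  let ?\<mu> = "second_deriv_measure f"
  define P where "P n v = (LINT u|lborel. M n u * \<kappa> n (u - v))" for n v
  have [measurable]: "\<kappa> n \<in> borel_measurable borel" for n
    using smooth_kernel.measurable_kernel(1)[OF kernel] .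
  have int: "integrable lborel (\<lambda>u. M n u * \<kappa> n (u - v))" for n v
  proof (rule Bochner_Integration.integrable_bound)
    show "integrable lborel (\<lambda>u. C * \<kappa> n (u - v))"
      using smooth_kernel.integrable_shifted[OF kernel] by simp
    show "AE u in lborel. norm (M n u * \<kappa> n (u - v)) \<le> norm (C * \<kappa> n (u - v))"
      using bdd by (intro AE_I2) (auto simp: abs_mult intro!: mult_right_mono order_trans[OF bdd])
  qed measurable
  have eq: "(LINT u|lborel. M n u * convolution (deriv (\<kappa> n)) (left_deriv f) u) - (LINT u|?\<mu>. M n u)
      = (LINT v|?\<mu>. P n v - M n v)" for n
    using integral_mult_second_deriv_convolution[OF kernel[of n] M[of n] bdd[of n] suppM[of n]]
      integrable_second_deriv[OF M[of n] bdd[of n] suppM[of n]]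
    by (simp add: P_def)
  have "(\<lambda>n. LINT v|?\<mu>. P n v - M n v) \<longlonglongrightarrow> (LINT v|?\<mu>. 0)"
  proof (rule integral_dominated_convergence[where w = "\<lambda>v. 2 * C * indicator {a - R..b} v"])
    show "integrable ?\<mu> (\<lambda>v. 2 * C * indicator {a - R..b} v)"
      using emeasure_second_deriv_interval_finite by (auto intro!: integrable_real_indicator)
    show "AE v in ?\<mu>. (\<lambda>n. P n v - M n v) \<longlonglongrightarrow> 0"
    proof (intro AE_I2 LIMSEQ_I)
      fix v e :: real assume "0 < e"
      then obtain d where d: "0 < d" "\<And>n u. u \<in> {v..<v + d} \<Longrightarrow> \<bar>M n u - M n v\<bar> \<le> e / 2"
        using right[of "e / 2" v] by auto
      obtain N where N: "\<And>n. n \<ge> N \<Longrightarrow> \<rho> n < d"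
        using order_tendstoD(2)[OF \<rho>(1) d(1)] unfolding eventually_sequentially by blast
      have "\<bar>P n v - M n v\<bar> \<le> e / 2" if "n \<ge> N" for n
        unfolding P_def using N[OF that]
        by (intro smooth_kernel.average_close_shifted[OF kernel M int] d(2)) auto
      then show "\<exists>N. \<forall>n\<ge>N. norm (P n v - M n v - 0) < e"
        using \<open>0 < e\<close> by (intro exI[of _ N]) fastforce
    qed
    show "AE v in ?\<mu>. norm (P n v - M n v) \<le> 2 * C * indicator {a - R..b} v" for n
    proof (intro AE_I2)
      fix v
      show "norm (P n v - M n v) \<le> 2 * C * indicator {a - R..b} v"
      proof (cases "v \<in> {a - R..b}")
        case True
        have "\<bar>M n u - M n v\<bar> \<le> 2 * C" for u using bdd[of n u] bdd[of n v] by linarith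
        then have "\<bar>P n v - M n v\<bar> \<le> 2 * C"
          unfolding P_def
          by (intro smooth_kernel.average_close_shifted[OF kernel M int]) auto
        then show ?thesis using True by simp
      next
        case False
        have "0 \<le> R"
        proof (rule ccontr)
          assume "\<not> 0 \<le> R"
          then have "\<kappa> n z = 0" for z
            using smooth_kernel.supp[OF kernel, of n z] \<rho>(2)[of n] by (cases "\<kappa> n z = 0") auto
          then show False using smooth_kernel.mass[OF kernel, of n] by simp
        qed
        have "M n u = 0 \<or> \<kappa> n (u - v) = 0" for u
          using smooth_kernel.supp[OF kernel, of n "u - v"] suppM[of n u] \<rho>(2)[of n] False
          by (cases "M n u = 0"; cases "\<kappa> n (u - v) = 0") auto
        then have "(\<lambda>u. M n u * \<kappa> n (u - v)) = (\<lambda>_. 0)"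
          by (simp add: fun_eq_iff)
        moreover have "M n v = 0" using suppM[of n v] False \<open>0 \<le> R\<close> by (cases "M n v = 0") auto
        ultimately show ?thesis using False by (simp add: P_def)
      qed
    qed
  qed (auto simp: P_def)
  then show ?thesis unfolding eq by simp
qed

end

section \<open>Discrete local times and Foellmer sums\<close>

lemma partition_seq_mono: "partition_seq \<pi> \<Longrightarrow> \<pi> j \<le> \<pi> (Suc j)"
  by (cases "\<pi> (Suc j) < \<infinity>") (auto simp: partition_seq_def less_imp_le)

lemma partition_seq_eventually_ge:
  assumes "partition_seq \<pi>"
  obtains N where "\<And>j. N \<le> j \<Longrightarrow> ereal t \<le> \<pi> j"
proof -
  have "\<forall>\<^sub>F j in sequentially. ereal t < \<pi> j"
    using assms by (intro order_tendstoD(1)[of \<pi> \<infinity>]) (auto simp: partition_seq_def)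
  then obtain N where "\<And>j. N \<le> j \<Longrightarrow> ereal t < \<pi> j"
    unfolding eventually_sequentially by blast
  then show ?thesis by (intro that[of N] less_imp_le)
qed

lemma path_at_stopped_mem:
  assumes "partition_seq \<pi>" "0 \<le> t"
  shows "path_at x (min (\<pi> j) (ereal t)) \<in> x ` {0..t}"
proof -
  have "0 \<le> min (\<pi> j) (ereal t)" "min (\<pi> j) (ereal t) \<le> ereal t"
    using assms by (auto simp: partition_seq_def)
  then show ?thesis
    by (cases "min (\<pi> j) (ereal t)") (auto simp: path_at_def)
qed

lemma half_open_subset: "a \<in> {A..B} \<Longrightarrow> b \<in> {A..B} \<Longrightarrow> half_open a b \<subseteq> {A..B}"
  by (auto simp: half_open_def)

lemma borel_half_open [measurable]: "half_open a b \<in> sets borel"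
  by (simp add: half_open_def)

text \<open>The remainder of first-order Taylor expansion is \<open>\<integral> (b - u) F''(u) du\<close> from \<open>a\<close> to \<open>b\<close>. For
  \<open>b < a\<close> the orientation of the integral and the sign of \<open>b - u\<close> are both reversed, which
  is why an absolute value and an unoriented interval describe both cases.\<close>

lemma taylor_half_open:
  fixes F h k :: "real \<Rightarrow> real"
  assumes F: "\<And>u. (F has_real_derivative h u) (at u)"
    and h: "\<And>u. (h has_real_derivative k u) (at u)" and k: "continuous_on UNIV k"
  shows "integrable lborel (\<lambda>u. indicator (half_open a b) u * \<bar>b - u\<bar> * k u)"
    and "F b - F a = h a * (b - a) + (LINT u|lborel. indicator (half_open a b) u * \<bar>b - u\<bar> * k u)"
proof -
  define l where "l = min a b"
  define m where "m = max a b"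
  define \<sigma> where "\<sigma> = (if a \<le> b then 1 else - 1 :: real)"
  have lm: "l \<le> m" by (simp add: l_def m_def)
  have kc: "isCont k u" for u using k by (simp add: continuous_on_eq_continuous_at)
  have [measurable]: "k \<in> borel_measurable borel" using k by (rule borel_measurable_continuous_onI)
  have der: "((\<lambda>u. \<sigma> * ((b - u) * h u + F u)) has_real_derivative \<sigma> * (b - u) * k u) (at u)" for u
    by (auto intro!: derivative_eq_intros F h simp: algebra_simps)
  have fin: "has_bochner_integral lborel (\<lambda>u. (\<sigma> * (b - u) * k u) * indicator {l..m} u)
      (\<sigma> * ((b - m) * h m + F m) - \<sigma> * ((b - l) * h l + F l))"
    by (rule has_bochner_integral_FTC_Icc_real[OF lm der]) (intro continuous_intros kc)
  have ae: "AE u in lborel. (\<sigma> * (b - u) * k u) * indicator {l..m} u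
      = indicator (half_open a b) u * \<bar>b - u\<bar> * k u"
    using AE_lborel_singleton[of m]
    by eventually_elim
      (auto simp: indicator_def half_open_def \<sigma>_def l_def m_def min_def max_def split: if_splits)
  have "has_bochner_integral lborel (\<lambda>u. indicator (half_open a b) u * \<bar>b - u\<bar> * k u)
      (\<sigma> * ((b - m) * h m + F m) - \<sigma> * ((b - l) * h l + F l))"
    by (rule has_bochner_integralI_AE[OF fin _ ae]) measurable
  moreover have "\<sigma> * ((b - m) * h m + F m) - \<sigma> * ((b - l) * h l + F l) = F b - F a - h a * (b - a)"
    by (simp add: \<sigma>_def l_def m_def min_def max_def algebra_simps)
  ultimately show "integrable lborel (\<lambda>u. indicator (half_open a b) u * \<bar>b - u\<bar> * k u)"
    and "F b - F a = h a * (b - a) + (LINT u|lborel. indicator (half_open a b) u * \<bar>b - u\<bar> * k u)"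
    by (simp_all add: has_bochner_integral_iff)
qed

lemma discrete_local_time_eq_0:
  assumes \<pi>: "partition_seq \<pi>" and t: "0 \<le> t" and range: "x ` {0..t} \<subseteq> {A..B}" and u: "u \<notin> {A..B}"
  shows "discrete_local_time \<pi> x t u = 0"
proof -
  have "u \<notin> half_open (path_at x (min (\<pi> j) (ereal t))) (path_at x (min (\<pi> (Suc j)) (ereal t)))" for j
    using half_open_subset[of "path_at x (min (\<pi> j) (ereal t))" A B "path_at x (min (\<pi> (Suc j)) (ereal t))"]
      path_at_stopped_mem[OF \<pi> t, of x] range u by blast
  then show ?thesis by (simp add: discrete_local_time_def)
qed

text \<open>Telescoping over the stopped partition points; the Taylor remainders are by construction
  the terms of the discrete local time.\<close>

lemma discrete_ito_formula:
  fixes F h k :: "real \<Rightarrow> real"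
  assumes \<pi>: "partition_seq \<pi>" and t: "0 \<le> t"
    and F: "\<And>u. (F has_real_derivative h u) (at u)"
    and h: "\<And>u. (h has_real_derivative k u) (at u)" and k: "continuous_on UNIV k"
  shows "follmer_sum \<pi> h x t =
    F (x t) - F (x 0) - 1 / 2 * (LINT u|lborel. discrete_local_time \<pi> x t u * k u)"
proof -
  define y where "y j = path_at x (min (\<pi> j) (ereal t))" for j
  obtain N where N: "\<And>j. N \<le> j \<Longrightarrow> ereal t \<le> \<pi> j"
    using partition_seq_eventually_ge[OF \<pi>] by blast
  have yN: "y j = x t" if "N \<le> j" for j
    using N[OF that] by (simp add: y_def min_absorb2 path_at_def)
  have y0: "y 0 = x 0"
    using \<pi> t by (simp add: y_def partition_seq_def path_at_def min_absorb1 zero_ereal_def)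
  (* Beyond t the integrand is evaluated at the unstopped point, but there the increment is 0. *)
  have start: "h (path_at x (\<pi> j)) * (y (Suc j) - y j) = h (y j) * (y (Suc j) - y j)" for j
  proof (cases "\<pi> j \<le> ereal t")
    case True
    then show ?thesis by (simp add: y_def min_absorb1)
  next
    case False
    then have "ereal t \<le> \<pi> j" "ereal t \<le> \<pi> (Suc j)"
      using partition_seq_mono[OF \<pi>, of j] by auto
    then show ?thesis by (simp add: y_def min_absorb2)
  qed
  have sum: "follmer_sum \<pi> h x t = (\<Sum>j<N. h (y j) * (y (Suc j) - y j))"
    unfolding follmer_sum_def y_def[symmetric] start
    by (rule suminf_finite) (auto simp: yN)
  have loc: "discrete_local_time \<pi> x t u =
      2 * (\<Sum>j<N. indicator (half_open (y j) (y (Suc j))) u * \<bar>y (Suc j) - u\<bar>)" for u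
    unfolding discrete_local_time_def y_def[symmetric]
    by (subst suminf_finite[of "{..<N}"]) (auto simp: yN half_open_def)
  have "F (x t) - F (x 0) = (\<Sum>j<N. F (y (Suc j)) - F (y j))"
    using sum_lessThan_telescope[of "\<lambda>j. F (y j)" N] yN[of N] y0 by simp
  also have "\<dots> = (\<Sum>j<N. h (y j) * (y (Suc j) - y j)) +
      (\<Sum>j<N. LINT u|lborel. indicator (half_open (y j) (y (Suc j))) u * \<bar>y (Suc j) - u\<bar> * k u)"
    unfolding taylor_half_open(2)[OF F h k] by (rule sum.distrib)
  also have "(\<Sum>j<N. LINT u|lborel. indicator (half_open (y j) (y (Suc j))) u * \<bar>y (Suc j) - u\<bar> * k u)
      = (LINT u|lborel. (\<Sum>j<N. indicator (half_open (y j) (y (Suc j))) u * \<bar>y (Suc j) - u\<bar> * k u))"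
    using taylor_half_open(1)[OF F h k] by (subst Bochner_Integration.integral_sum) auto
  also have "\<dots> = (LINT u|lborel. 1 / 2 * (discrete_local_time \<pi> x t u * k u))"
  proof (rule Bochner_Integration.integral_cong[OF refl])
    fix u
    show "(\<Sum>j<N. indicator (half_open (y j) (y (Suc j))) u * \<bar>y (Suc j) - u\<bar> * k u) =
        1 / 2 * (discrete_local_time \<pi> x t u * k u)"
      unfolding loc sum_distrib_right[symmetric] by simp
  qed
  also have "\<dots> = 1 / 2 * (LINT u|lborel. discrete_local_time \<pi> x t u * k u)"
    by (rule integral_mult_right_zero)
  finally show ?thesis unfolding sum by simp
qed

lemma Linf_continuous_cutoff:
  assumes k: "continuous_on UNIV k"
  shows "(\<lambda>u. k u * indicator {A..B} u) \<in> Linf"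
proof -
  have "bounded (k ` {A..B})"
    using k by (intro compact_imp_bounded compact_continuous_image) (auto intro: continuous_on_subset)
  then obtain C where C: "\<And>u. u \<in> {A..B} \<Longrightarrow> \<bar>k u\<bar> \<le> C"
    unfolding bounded_iff real_norm_def by blast
  have "\<bar>k u * indicator {A..B} u\<bar> \<le> \<bar>C\<bar>" for u
    using C[of u] by (auto simp: indicator_def)
  moreover have "k \<in> borel_measurable borel" using k by (rule borel_measurable_continuous_onI)
  ultimately show ?thesis unfolding Linf_def by (auto intro!: exI[of _ "\<bar>C\<bar>"])
qed

text \<open>The second derivative \<open>k\<close> may be unbounded, but only its values on the range of the path
  count. Cutting it off there turns it into a test function for weak convergence.\<close>

lemma follmer_sum_tendsto:
  fixes F h k :: "real \<Rightarrow> real"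
  assumes \<pi>: "\<And>n. partition_seq (\<pi>s n)" and t: "0 \<le> t" and \<Lambda>: "is_pathwise_local_time \<pi>s x \<Lambda>"
    and range: "x ` {0..t} \<subseteq> {A..B}"
    and F: "\<And>u. (F has_real_derivative h u) (at u)"
    and h: "\<And>u. (h has_real_derivative k u) (at u)" and k: "continuous_on UNIV k"
  shows "(\<lambda>n. follmer_sum (\<pi>s n) h x t) \<longlonglongrightarrow>
    F (x t) - F (x 0) - 1 / 2 * (LINT u|lborel. \<Lambda> t u * (k u * indicator {A..B} u))"
proof -
  have eq: "discrete_local_time (\<pi>s n) x t u * (k u * indicator {A..B} u) =
      discrete_local_time (\<pi>s n) x t u * k u" for n u
    using discrete_local_time_eq_0[OF \<pi> t range, of u] by (cases "u \<in> {A..B}") auto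
  have weak: "weakly_converges_L1 (\<lambda>n. discrete_local_time (\<pi>s n) x t) (\<Lambda> t)"
    using \<Lambda> t by (simp add: is_pathwise_local_time_def)
  have "(\<lambda>n. LINT u|lborel. discrete_local_time (\<pi>s n) x t u * (k u * indicator {A..B} u))
      \<longlonglongrightarrow> (LINT u|lborel. \<Lambda> t u * (k u * indicator {A..B} u))"
    by (rule bspec[OF weak[unfolded weakly_converges_L1_def, THEN conjunct2, THEN conjunct2]
          Linf_continuous_cutoff[OF k]])
  then have "(\<lambda>n. LINT u|lborel. discrete_local_time (\<pi>s n) x t u * k u) \<longlonglongrightarrow>
      (LINT u|lborel. \<Lambda> t u * (k u * indicator {A..B} u))"
    unfolding eq .
  then show ?thesis
    unfolding discrete_ito_formula[OF \<pi> t F h k]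
    by (rule tendsto_diff[OF tendsto_const tendsto_mult[OF tendsto_const]])
qed

text \<open>The sign of \<open>\<Lambda> t\<close> outside the range is a bounded test function. It annihilates every
  discrete local time, hence also the weak limit.\<close>

lemma local_time_AE_eq_0:
  assumes \<pi>: "\<And>n. partition_seq (\<pi>s n)" and t: "0 \<le> t" and \<Lambda>: "is_pathwise_local_time \<pi>s x \<Lambda>"
    and range: "x ` {0..t} \<subseteq> {A..B}"
  shows "AE u in lborel. u \<notin> {A..B} \<longrightarrow> \<Lambda> t u = 0"
proof -
  have weak: "weakly_converges_L1 (\<lambda>n. discrete_local_time (\<pi>s n) x t) (\<Lambda> t)"
    using \<Lambda> t by (simp add: is_pathwise_local_time_def)
  then have int: "integrable lborel (\<Lambda> t)" by (simp add: weakly_converges_L1_def)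
  then have [measurable]: "\<Lambda> t \<in> borel_measurable borel" by auto
  define \<phi> where "\<phi> u = sgn (\<Lambda> t u) * indicator (- {A..B}) u" for u
  have "\<phi> \<in> Linf"
    unfolding Linf_def \<phi>_def by (auto intro!: exI[of _ 1] simp: indicator_def abs_sgn_eq)
  then have "(\<lambda>n. LINT u|lborel. discrete_local_time (\<pi>s n) x t u * \<phi> u) \<longlonglongrightarrow>
      (LINT u|lborel. \<Lambda> t u * \<phi> u)"
    using weak by (simp add: weakly_converges_L1_def)
  moreover have "(\<lambda>u. discrete_local_time (\<pi>s n) x t u * \<phi> u) = (\<lambda>_. 0)" for n
    using discrete_local_time_eq_0[OF \<pi> t range] by (auto simp: fun_eq_iff \<phi>_def indicator_def)
  ultimately have "(LINT u|lborel. \<Lambda> t u * \<phi> u) = 0"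
    by (simp add: LIMSEQ_const_iff)
  moreover have eq: "\<Lambda> t u * \<phi> u = \<bar>\<Lambda> t u\<bar> * indicator (- {A..B}) u" for u
    by (simp add: \<phi>_def abs_sgn mult.assoc)
  ultimately have "(LINT u|lborel. \<bar>\<Lambda> t u\<bar> * indicator (- {A..B}) u) = 0" by simp
  moreover have "integrable lborel (\<lambda>u. \<bar>\<Lambda> t u\<bar> * indicator (- {A..B}) u)"
    using int by (intro integrable_real_mult_indicator) auto
  ultimately have "AE u in lborel. \<bar>\<Lambda> t u\<bar> * indicator (- {A..B}) u = 0"
    by (subst (asm) integral_nonneg_eq_0_iff_AE) auto
  then show ?thesis
    by eventually_elim (auto simp: indicator_def split: if_splits)
qed

text \<open>A right-continuous function is the pointwise limit of its values on the grids of mesh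
  \<open>1 / (n + 1)\<close>, sampled at the next grid point strictly to the right. Borel measurability of the local
  time is needed because the measure \<open>f''\<close> may charge Lebesgue null sets.\<close>

lemma right_continuous_borel_measurable:
  fixes \<phi> :: "real \<Rightarrow> real"
  assumes right: "\<And>u. (\<phi> \<longlongrightarrow> \<phi> u) (at_right u)"
  shows "\<phi> \<in> borel_measurable borel"
proof (rule borel_measurable_LIMSEQ_real)
  let ?a = "\<lambda>n u. (real_of_int \<lfloor>real (Suc n) * u\<rfloor> + 1) / real (Suc n)"
  show "(\<lambda>u. \<phi> (?a n u)) \<in> borel_measurable borel" for n
  proof -
    have "(\<lambda>i::int. \<phi> ((real_of_int i + 1) / real (Suc n))) \<in> measurable (count_space UNIV) borel"
      by simp
    moreover have "(\<lambda>u. \<lfloor>real (Suc n) * u\<rfloor>) \<in> measurable borel (count_space UNIV)"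
      by measurable
    ultimately show ?thesis by (rule measurable_compose[rotated])
  qed
  fix u :: real
  have gt: "u < ?a n u" for n
    using floor_correct[of "real (Suc n) * u"]
    by (simp add: pos_less_divide_eq mult.commute del: of_nat_Suc)
  have le: "?a n u \<le> u + 1 / real (Suc n)" for n
  proof -
    have "?a n u \<le> (real (Suc n) * u + 1) / real (Suc n)"
      by (intro divide_right_mono) auto
    also have "\<dots> = u + 1 / real (Suc n)" by (simp add: field_simps del: of_nat_Suc)
    finally show ?thesis .
  qed
  have lim: "(\<lambda>n. u + 1 / real (Suc n)) \<longlonglongrightarrow> u"
    using tendsto_add[OF tendsto_const LIMSEQ_Suc[OF lim_1_over_n], of u] by simp
  have lower: "\<forall>\<^sub>F n in sequentially. u \<le> ?a n u"
    using gt by (intro always_eventually allI less_imp_le)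
  have upper: "\<forall>\<^sub>F n in sequentially. ?a n u \<le> u + 1 / real (Suc n)"
    using le by (intro always_eventually allI)
  have "(\<lambda>n. ?a n u) \<longlonglongrightarrow> u"
    by (rule tendsto_sandwich[OF lower upper tendsto_const lim])
  moreover have "\<forall>\<^sub>F n in sequentially. ?a n u \<in> {u<..} \<and> ?a n u \<noteq> u"
  proof (intro always_eventually allI)
    show "?a n u \<in> {u<..} \<and> ?a n u \<noteq> u" for n using gt[of n] by (metis greaterThan_iff less_irrefl)
  qed
  ultimately have "filterlim (\<lambda>n. ?a n u) (at_right u) sequentially"
    unfolding filterlim_at by (rule conjI[rotated])
  then show "(\<lambda>n. \<phi> (?a n u)) \<longlonglongrightarrow> \<phi> u"
    by (rule filterlim_compose[OF right])
qed

text \<open>A nonzero value would persist on an interval to the right of \<open>u\<close>, which has positive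
  measure.\<close>

lemma right_continuous_eq_0:
  fixes \<phi> :: "real \<Rightarrow> real"
  assumes right: "(\<phi> \<longlongrightarrow> \<phi> u) (at_right u)"
    and ae: "AE v in lborel. v \<in> {u<..<w} \<longrightarrow> \<phi> v = 0" and "u < w"
  shows "\<phi> u = 0"
proof (rule ccontr)
  assume "\<phi> u \<noteq> 0"
  then have "\<forall>\<^sub>F v in at_right u. \<phi> v \<noteq> 0"
    using right by (rule tendsto_imp_eventually_ne[rotated])
  then obtain b where b: "u < b" "\<forall>v>u. v < b \<longrightarrow> \<phi> v \<noteq> 0"
    unfolding eventually_at_right_field by (elim exE conjE)
  have "AE v in lborel. v \<notin> {u<..<min b w}"
    using ae by eventually_elim (use b in auto)
  then have "emeasure lborel {u<..<min b w} = 0"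
    by (subst (asm) AE_iff_measurable[of "{u<..<min b w}"]) auto
  then show False using b(1) \<open>u < w\<close> by (simp add: min_def split: if_splits)
qed

lemma modification_AE_eq:
  assumes "is_modification L' L" "0 \<le> t"
  shows "AE u in lborel. L' t u = L t u"
proof -
  have "{u. L' t u \<noteq> L t u} \<in> null_sets lebesgue"
    using assms by (simp add: is_modification_def)
  then have "AE u in lebesgue. L' t u = L t u"
    by (rule AE_I') auto
  then show ?thesis by (simp add: AE_completion_iff)
qed

section \<open>Jointly cadlag families\<close>

text \<open>The quantifier exchange behind all uniformity statements here: a property that holds
  locally with some radius holds with one radius on a compact set.\<close>

lemma compact_uniform_radius:
  fixes K :: "'a::metric_space set"
  assumes K: "compact K"
    and loc: "\<And>t. t \<in> K \<Longrightarrow> \<exists>d>0. \<forall>s\<in>K. dist s t < d \<longrightarrow> P d s"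
    and mono: "\<And>d d' s. P d s \<Longrightarrow> 0 < d' \<Longrightarrow> d' \<le> d \<Longrightarrow> P d' s"
  shows "\<exists>d>(0::real). \<forall>s\<in>K. P d s"
proof -
  obtain \<delta> where \<delta>: "\<And>t. t \<in> K \<Longrightarrow> 0 < \<delta> t" "\<And>t s. t \<in> K \<Longrightarrow> s \<in> K \<Longrightarrow> dist s t < \<delta> t \<Longrightarrow> P (\<delta> t) s"
    using loc by metis
  have "t \<in> (\<Union>t\<in>K. ball t (\<delta> t))" if "t \<in> K" for t
    using that \<delta>(1)[OF that] by (intro UN_I[of t]) auto
  then have cover: "K \<subseteq> (\<Union>t\<in>K. ball t (\<delta> t))" by blast
  obtain J where J: "J \<subseteq> K" "finite J" "K \<subseteq> (\<Union>t\<in>J. ball t (\<delta> t))"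
    by (rule compactE_image[OF K open_ball cover])
  define d where "d = Min (insert 1 (\<delta> ` J))"
  have "0 < d" using J \<delta>(1) by (auto simp: d_def)
  moreover have "P d s" if s: "s \<in> K" for s
  proof -
    obtain t where t: "t \<in> J" "s \<in> ball t (\<delta> t)"
      using J(3) s by blast
    then have "P (\<delta> t) s"
      using \<delta>(2)[of t s] J(1) s by (auto simp: dist_commute)
    moreover have "d \<le> \<delta> t" using t(1) J(2) by (simp add: d_def)
    ultimately show ?thesis using mono \<open>0 < d\<close> by blast
  qed
  ultimately show ?thesis by blast
qed

text \<open>Choosing for each index a point at which the bound fails, if there is one, reduces
  uniform convergence to convergence along sequences. This avoids the supremum over time inside an integral, whose measurability
  would be unclear.\<close>

lemma uniform_limit_sequenceI:
  fixes F :: "nat \<Rightarrow> 'a \<Rightarrow> 'b::metric_space"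
  assumes seq: "\<And>\<tau>. (\<And>n. \<tau> n \<in> K) \<Longrightarrow> (\<lambda>n. dist (F n (\<tau> n)) (G (\<tau> n))) \<longlonglongrightarrow> 0"
  shows "uniform_limit K F G sequentially"
proof (cases "K = {}")
  case False
  then obtain t0 where "t0 \<in> K" by blast
  show ?thesis
  proof (rule uniform_limitI)
    fix e :: real assume "0 < e"
    define \<tau> where "\<tau> n = (if \<exists>t\<in>K. e \<le> dist (F n t) (G t) then SOME t. t \<in> K \<and> e \<le> dist (F n t) (G t) else t0)" for n
    have "\<tau> n \<in> K" and bad: "\<And>t. t \<in> K \<Longrightarrow> e \<le> dist (F n t) (G t) \<Longrightarrow> e \<le> dist (F n (\<tau> n)) (G (\<tau> n))" for n
      using someI_ex[of "\<lambda>t. t \<in> K \<and> e \<le> dist (F n t) (G t)"] \<open>t0 \<in> K\<close>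
      by (auto simp: \<tau>_def)
    then have "\<forall>\<^sub>F n in sequentially. dist (F n (\<tau> n)) (G (\<tau> n)) < e"
      using order_tendstoD(2)[OF seq \<open>0 < e\<close>] by blast
    then show "\<forall>\<^sub>F n in sequentially. \<forall>t\<in>K. dist (F n t) (G t) < e"
      by eventually_elim (meson bad leD leI)
  qed
qed simp

lemma jointly_cadlag_right:
  assumes M: "jointly_cadlag_continuous M" and t: "0 \<le> t" and e: "0 < e"
  shows "\<exists>d>0. \<forall>s\<ge>0. \<bar>s - t\<bar> < d \<longrightarrow> (\<forall>u\<in>{v..<v + d}. \<bar>M s u - M t v\<bar> < e)"
proof -
  have "((\<lambda>(s, v). M s v) \<longlongrightarrow> M t v) (at (t, v) within {0..} \<times> {v..})"
    using M t by (simp add: jointly_cadlag_continuous_def)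
  then obtain d where d: "0 < d" "\<And>p. p \<in> {0..} \<times> {v..} \<Longrightarrow> 0 < dist p (t, v) \<Longrightarrow> dist p (t, v) < d \<Longrightarrow>
      dist (case_prod M p) (M t v) < e"
    using e unfolding Lim_within by blast
  show ?thesis
  proof (intro exI[of _ "d / 2"] conjI allI impI ballI)
    fix s u assume "0 \<le> s" "\<bar>s - t\<bar> < d / 2" "u \<in> {v..<v + d / 2}"
    moreover have "dist (s, u) (t, v) \<le> \<bar>s - t\<bar> + \<bar>u - v\<bar>"
      using sqrt_sum_squares_le_sum_abs[of "s - t" "u - v"]
      by (simp add: dist_Pair_Pair dist_real_def)
    ultimately show "\<bar>M s u - M t v\<bar> < e"
      using d(2)[of "(s, u)"] e by (cases "(s, u) = (t, v)") (auto simp: dist_real_def)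
  qed (use d in auto)
qed

lemma jointly_cadlag_left:
  assumes M: "jointly_cadlag_continuous M" and t: "0 \<le> t"
  obtains d l where "0 < d" "\<And>s u. 0 \<le> s \<Longrightarrow> \<bar>s - t\<bar> < d \<Longrightarrow> u \<in> {v - d<..<v} \<Longrightarrow> \<bar>M s u - l\<bar> < 1"
proof -
  obtain l where "((\<lambda>(s, v). M s v) \<longlongrightarrow> l) (at (t, v) within {0..} \<times> {..<v})"
    using M t unfolding jointly_cadlag_continuous_def by blast
  then obtain d where d: "0 < d" "\<And>p. p \<in> {0..} \<times> {..<v} \<Longrightarrow> 0 < dist p (t, v) \<Longrightarrow> dist p (t, v) < d \<Longrightarrow>
      dist (case_prod M p) l < 1"
    unfolding Lim_within using zero_less_one by blast
  have "\<bar>M s u - l\<bar> < 1" if "0 \<le> s" "\<bar>s - t\<bar> < d / 2" "u \<in> {v - d / 2<..<v}" for s u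
  proof -
    have "dist (s, u) (t, v) \<le> \<bar>s - t\<bar> + \<bar>u - v\<bar>"
      using sqrt_sum_squares_le_sum_abs[of "s - t" "u - v"]
      by (simp add: dist_Pair_Pair dist_real_def)
    then show ?thesis using d(2)[of "(s, u)"] that by (auto simp: dist_real_def)
  qed
  then show ?thesis using that[of "d / 2" l] d(1) by simp
qed

lemma jointly_cadlag_uniform_right:
  assumes M: "jointly_cadlag_continuous M" and K: "compact K" "K \<subseteq> {0..}" and e: "0 < e"
  shows "\<exists>d>0. \<forall>s\<in>K. \<forall>u\<in>{v..<v + d}. \<bar>M s u - M s v\<bar> \<le> e"
proof (rule compact_uniform_radius[OF K(1)])
  fix t assume "t \<in> K"
  then have "0 \<le> t" using K by auto
  from jointly_cadlag_right[OF M this, of "e / 2" v] e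
  obtain d where d: "0 < d" "\<And>s u. 0 \<le> s \<Longrightarrow> \<bar>s - t\<bar> < d \<Longrightarrow> u \<in> {v..<v + d} \<Longrightarrow> \<bar>M s u - M t v\<bar> < e / 2"
    by auto
  have "\<bar>M s u - M s v\<bar> \<le> e" if "s \<in> K" "dist s t < d" "u \<in> {v..<v + d}" for s u
  proof -
    have s: "0 \<le> s" "\<bar>s - t\<bar> < d" using that K by (auto simp: dist_real_def)
    have "v \<in> {v..<v + d}" using d(1) by simp
    from d(2)[OF s that(3)] d(2)[OF s this] show ?thesis by linarith
  qed
  then show "\<exists>d>0. \<forall>s\<in>K. dist s t < d \<longrightarrow> (\<forall>u\<in>{v..<v + d}. \<bar>M s u - M s v\<bar> \<le> e)"
    using d(1) by blast
qed auto

lemma jointly_cadlag_bounded: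
  assumes M: "jointly_cadlag_continuous M" and K: "compact K" "K \<subseteq> {0..}"
  obtains C where "\<And>s u. s \<in> K \<Longrightarrow> u \<in> {a..b} \<Longrightarrow> \<bar>M s u\<bar> \<le> C"
proof -
  have "\<exists>d>0. \<forall>p\<in>K \<times> {a..b}. \<bar>case_prod M p\<bar> \<le> 1 / d"
  proof (rule compact_uniform_radius)
    show "compact (K \<times> {a..b})" using K by (intro compact_Times) auto
    fix p assume "p \<in> K \<times> {a..b}"
    then obtain t v where p: "p = (t, v)" "t \<in> K" "0 \<le> t" using K by (cases p) auto
    obtain d1 where d1: "0 < d1" "\<And>s u. 0 \<le> s \<Longrightarrow> \<bar>s - t\<bar> < d1 \<Longrightarrow> u \<in> {v..<v + d1} \<Longrightarrow> \<bar>M s u - M t v\<bar> < 1"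
      using jointly_cadlag_right[OF M p(3), of 1 v] by auto
    obtain d2 l where d2: "0 < d2" "\<And>s u. 0 \<le> s \<Longrightarrow> \<bar>s - t\<bar> < d2 \<Longrightarrow> u \<in> {v - d2<..<v} \<Longrightarrow> \<bar>M s u - l\<bar> < 1"
      using jointly_cadlag_left[OF M p(3), of v] by blast
    (* The radius doubles as the bound: a bound C is recorded as a radius of at most 1 / C,
       so that a smaller radius stands for a weaker bound. *)
    define C where "C = \<bar>M t v\<bar> + \<bar>l\<bar> + 1"
    define d where "d = min (min d1 d2) (1 / C)"
    have "0 < C" by (simp add: C_def)
    then have d: "0 < d" "d \<le> d1" "d \<le> d2" "d \<le> 1 / C"
      using d1(1) d2(1) by (auto simp: d_def)
    then have "C \<le> 1 / d" using \<open>0 < C\<close> by (simp add: field_simps)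
    show "\<exists>d>0. \<forall>q\<in>K \<times> {a..b}. dist q p < d \<longrightarrow> \<bar>case_prod M q\<bar> \<le> 1 / d"
    proof (intro exI[of _ d] conjI ballI impI d(1))
      fix q assume q: "q \<in> K \<times> {a..b}" "dist q p < d"
      obtain s u where su: "q = (s, u)" by (cases q)
      have "\<bar>s - t\<bar> < d" "\<bar>u - v\<bar> < d" "0 \<le> s"
        using q K dist_fst_le[of q p] dist_snd_le[of q p] by (auto simp: su p dist_real_def)
      then have "\<bar>M s u\<bar> \<le> C"
        using d1(2)[of s u] d2(2)[of s u] d(2,3) by (cases "v \<le> u") (auto simp: C_def)
      then show "\<bar>case_prod M q\<bar> \<le> 1 / d" using \<open>C \<le> 1 / d\<close> by (simp add: su)
    qed
  next
    show "\<bar>case_prod M p\<bar> \<le> 1 / d'" if "\<bar>case_prod M p\<bar> \<le> 1 / d" "0 < d'" "d' \<le> d" for d d' p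
      using that by (intro order_trans[OF that(1)]) (auto intro!: divide_left_mono)
  qed
  then show ?thesis using that by fastforce
qed

text \<open>With this, results on families at all times of a compact set also apply to one fixed
  time, where only regularity in the space variable is assumed.\<close>

lemma cadlag_imp_jointly_cadlag_const:
  assumes \<phi>: "cadlag \<phi>"
  shows "jointly_cadlag_continuous (\<lambda>_. \<phi>)"
  unfolding jointly_cadlag_continuous_def
proof (intro allI impI conjI)
  fix t u :: real
  have right: "(\<phi> \<longlongrightarrow> \<phi> u) (at_right u)" using \<phi> by (simp add: cadlag_def)
  show "((\<lambda>(s, v). \<phi> v) \<longlongrightarrow> \<phi> u) (at (t, u) within {0..} \<times> {u..})"
  proof (rule topological_tendstoI)
    fix S assume "open S" "\<phi> u \<in> S"
    from topological_tendstoD[OF right this]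
    obtain U where U: "open U" "u \<in> U" "\<And>v. v \<in> U \<Longrightarrow> v > u \<Longrightarrow> \<phi> v \<in> S"
      unfolding eventually_at_topological by auto
    have "\<phi> v \<in> S" if "v \<in> U" "u \<le> v" for v
      using U(3)[of v] that \<open>\<phi> u \<in> S\<close> by (cases "v = u") auto
    then show "\<forall>\<^sub>F p in at (t, u) within {0..} \<times> {u..}. (case p of (s, v) \<Rightarrow> \<phi> v) \<in> S"
      unfolding eventually_at_topological using U(1,2)
      by (intro exI[of _ "UNIV \<times> U"]) (auto intro: open_Times)
  qed
  obtain l where left: "(\<phi> \<longlongrightarrow> l) (at_left u)" using \<phi> unfolding cadlag_def by blast
  show "\<exists>l. ((\<lambda>(s, v). \<phi> v) \<longlongrightarrow> l) (at (t, u) within {0..} \<times> {..<u})"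
  proof (intro exI topological_tendstoI)
    fix S assume "open S" "l \<in> S"
    from topological_tendstoD[OF left this]
    obtain U where U: "open U" "u \<in> U" "\<And>v. v \<in> U \<Longrightarrow> v < u \<Longrightarrow> \<phi> v \<in> S"
      unfolding eventually_at_topological by auto
    then show "\<forall>\<^sub>F p in at (t, u) within {0..} \<times> {..<u}. (case p of (s, v) \<Rightarrow> \<phi> v) \<in> S"
      unfolding eventually_at_topological
      by (intro exI[of _ "UNIV \<times> U"]) (auto intro: open_Times)
  qed
qed

section \<open>Convergence of mollified functions and second derivatives\<close>

lemma uniform_limit_convolution:
  fixes f :: "real \<Rightarrow> real"
  assumes f: "continuous_on UNIV f"
    and kernel: "\<And>n. smooth_kernel (\<kappa> n) (\<rho> n)" and \<rho>: "\<rho> \<longlonglongrightarrow> 0"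
  shows "uniform_limit {a..b} (\<lambda>n. convolution (\<kappa> n) f) f sequentially"
proof (rule uniform_limitI)
  fix e :: real assume e: "0 < e"
  have [measurable]: "f \<in> borel_measurable borel" using f by (rule borel_measurable_continuous_onI)
  have bdd: "bounded (f ` {c..d})" for c d
    using f by (intro compact_imp_bounded compact_continuous_image) (auto intro: continuous_on_subset)
  have "uniformly_continuous_on {a - 1..b} f"
    using f by (intro compact_uniformly_continuous) (auto intro: continuous_on_subset)
  then obtain d where d: "0 < d"
    "\<And>u y. u \<in> {a - 1..b} \<Longrightarrow> y \<in> {a - 1..b} \<Longrightarrow> dist y u < d \<Longrightarrow> dist (f y) (f u) < e / 2"
    unfolding uniformly_continuous_on_def using e by (metis half_gt_zero)
  have "\<forall>\<^sub>F n in sequentially. \<rho> n < min d 1"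
    using d(1) by (intro order_tendstoD(2)[OF \<rho>]) auto
  then show "\<forall>\<^sub>F n in sequentially. \<forall>u\<in>{a..b}. dist (convolution (\<kappa> n) f u) (f u) < e"
  proof eventually_elim
    case (elim n)
    interpret smooth_kernel "\<kappa> n" "\<rho> n" by (rule kernel)
    show ?case
    proof
      fix u assume u: "u \<in> {a..b}"
      have "\<bar>convolution (\<kappa> n) f u - f u\<bar> \<le> e / 2"
      proof (rule average_close)
        show "integrable lborel (\<lambda>y. \<kappa> n (u - y) * f y)"
          by (rule integrable_kernel_mult[OF cont supp _ bdd]) measurable
        fix y assume y: "y \<in> {u - \<rho> n..u}"
        then have "dist (f y) (f u) < e / 2"
          using elim u by (intro d(2)) (auto simp: dist_real_def)
        then show "\<bar>f y - f u\<bar> \<le> e / 2" by (simp add: dist_real_def)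
      qed measurable
      then show "dist (convolution (\<kappa> n) f u) (f u) < e"
        using e by (simp add: dist_real_def)
    qed
  qed
qed

lemma uniform_limit_mollified_second_deriv:
  assumes f: "convex_on UNIV f"
    and kernel: "\<And>n. smooth_kernel (\<kappa> n) (\<rho> n)" and \<rho>: "\<rho> \<longlonglongrightarrow> 0"
    and M: "jointly_cadlag_continuous M" and K: "compact K" "K \<subseteq> {0..}"
    and meas: "\<And>s. s \<in> K \<Longrightarrow> M s \<in> borel_measurable borel"
    and supp: "\<And>s u. s \<in> K \<Longrightarrow> M s u \<noteq> 0 \<Longrightarrow> u \<in> {a..b}"
  shows "uniform_limit K (\<lambda>n s. LINT u|lborel. M s u * convolution (deriv (\<kappa> n)) (left_deriv f) u)
    (\<lambda>s. LINT u|second_deriv_measure f. M s u) sequentially"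
proof (rule uniform_limit_sequenceI)
  fix \<tau> :: "nat \<Rightarrow> real" assume \<tau>: "\<And>n. \<tau> n \<in> K"
  obtain C where C: "\<And>s u. s \<in> K \<Longrightarrow> u \<in> {a..b} \<Longrightarrow> \<bar>M s u\<bar> \<le> C"
    using jointly_cadlag_bounded[OF M K] by blast
  have bdd: "\<bar>M (\<tau> n) u\<bar> \<le> \<bar>C\<bar>" for n u
    using C[OF \<tau>[of n], of u] supp[OF \<tau>[of n], of u] by (cases "M (\<tau> n) u = 0") auto
  obtain R where R: "\<And>n. \<rho> n \<le> R"
    using convergent_imp_Bseq[OF convergentI[OF \<rho>]] unfolding Bseq_def real_norm_def
    by (metis abs_le_D1)
  have right: "\<exists>d>0. \<forall>n. \<forall>u\<in>{v..<v + d}. \<bar>M (\<tau> n) u - M (\<tau> n) v\<bar> \<le> e" if "0 < e" for v e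
    using jointly_cadlag_uniform_right[OF M K that, of v] \<tau> by blast
  show "(\<lambda>n. dist (LINT u|lborel. M (\<tau> n) u * convolution (deriv (\<kappa> n)) (left_deriv f) u)
      (LINT u|second_deriv_measure f. M (\<tau> n) u)) \<longlonglongrightarrow> 0"
    using tendsto_rabs_zero[OF mollified_second_deriv_tendsto[OF f kernel \<rho> R meas[OF \<tau>] bdd supp[OF \<tau>] right]]
    by (simp add: dist_real_def)
qed

text \<open>Joint regularity gives convergence of \<open>M s u\<close> in \<open>s\<close> at every single \<open>u\<close>, and bounds that
  are uniform on bounded time intervals.\<close>

lemma continuous_on_integral_second_deriv:
  assumes f: "convex_on UNIV f" and M: "jointly_cadlag_continuous M"
    and meas: "\<And>s. 0 \<le> s \<Longrightarrow> M s \<in> borel_measurable borel"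
    and supp: "\<And>T. \<exists>a b. \<forall>s\<in>{0..T}. \<forall>u. M s u \<noteq> 0 \<longrightarrow> u \<in> {a..b}"
  shows "continuous_on {0..} (\<lambda>s. LINT u|second_deriv_measure f. M s u)"
  unfolding continuous_on_sequentially
proof (intro ballI allI impI)
  fix X :: "nat \<Rightarrow> real" and t :: real
  assume "t \<in> {0..}" and "(\<forall>n. X n \<in> {0..}) \<and> X \<longlonglongrightarrow> t"
  then have t: "0 \<le> t" and X: "\<And>n. 0 \<le> X n" "X \<longlonglongrightarrow> t" by auto
  obtain T where T: "\<And>n. X n \<in> {0..T}"
    using convergent_imp_Bseq[OF convergentI[OF X(2)]] X(1) unfolding Bseq_def real_norm_def
    by (metis abs_le_D1 atLeastAtMost_iff)
  obtain a b where ab: "\<And>s u. s \<in> {0..T} \<Longrightarrow> M s u \<noteq> 0 \<Longrightarrow> u \<in> {a..b}"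
    using supp[of T] by blast
  obtain C where C: "\<And>s u. s \<in> {0..T} \<Longrightarrow> u \<in> {a..b} \<Longrightarrow> \<bar>M s u\<bar> \<le> C"
    using jointly_cadlag_bounded[OF M compact_Icc[of 0 T]] by (metis atLeastatMost_subset_iff atLeast_iff atLeastAtMost_iff subsetI)
  have "(\<lambda>n. LINT u|second_deriv_measure f. M (X n) u) \<longlonglongrightarrow> (LINT u|second_deriv_measure f. M t u)"
  proof (rule integral_dominated_convergence[where w = "\<lambda>u. C * indicator {a..b} u"])
    show "integrable (second_deriv_measure f) (\<lambda>u. C * indicator {a..b} u)"
      using emeasure_second_deriv_interval_finite[OF f]
      by (auto intro!: integrable_real_indicator)
    show "AE u in second_deriv_measure f. (\<lambda>n. M (X n) u) \<longlonglongrightarrow> M t u"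
    proof (intro AE_I2 LIMSEQ_I)
      fix u e :: real assume "0 < e"
      then obtain d where d: "0 < d" "\<And>s. 0 \<le> s \<Longrightarrow> \<bar>s - t\<bar> < d \<Longrightarrow> \<bar>M s u - M t u\<bar> < e"
        using jointly_cadlag_right[OF M t, of e u] by fastforce
      obtain N where "\<And>n. N \<le> n \<Longrightarrow> \<bar>X n - t\<bar> < d"
        using LIMSEQ_D[OF X(2) d(1)] by auto
      then show "\<exists>N. \<forall>n\<ge>N. norm (M (X n) u - M t u) < e" using d(2) X(1) by auto
    qed
    show "AE u in second_deriv_measure f. norm (M (X n) u) \<le> C * indicator {a..b} u" for n
    proof (intro AE_I2)
      show "norm (M (X n) u) \<le> C * indicator {a..b} u" for u
        using C[OF T, of u n] ab[OF T, of n u] by (cases "u \<in> {a..b}") auto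
    qed
  qed (simp_all add: measurable_cong_sets[OF sets_second_deriv_measure refl] meas t X(1))
  then show "((\<lambda>s. LINT u|second_deriv_measure f. M s u) \<circ> X) \<longlonglongrightarrow> (LINT u|second_deriv_measure f. M t u)"
    by (simp add: o_def)
qed

section \<open>The change of variable formula for convex functions\<close>

locale path_with_local_time =
  fixes x :: "real \<Rightarrow> real" and \<pi>s :: "nat \<Rightarrow> nat \<Rightarrow> ereal" and \<Lambda> L :: "real \<Rightarrow> real \<Rightarrow> real"
  assumes continuous_path: "continuous_on {0..} x"
    and partitions: "partition_seq (\<pi>s n)"
    and local_time: "is_pathwise_local_time \<pi>s x \<Lambda>"
    and modification: "is_modification L \<Lambda>"
    and cadlag_L: "0 \<le> t \<Longrightarrow> cadlag (L t)"
begin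

lemma path_range:
  obtains A B where "x ` {0..T} \<subseteq> {A..B}"
proof -
  have "bounded (x ` {0..T})"
    using continuous_path
    by (intro compact_imp_bounded compact_continuous_image) (auto intro: continuous_on_subset)
  then obtain C where "\<And>y. y \<in> x ` {0..T} \<Longrightarrow> \<bar>y\<bar> \<le> C"
    unfolding bounded_iff real_norm_def by blast
  then have "x ` {0..T} \<subseteq> {- C..C}" by fastforce
  then show ?thesis by (rule that)
qed

lemma right_continuous_L: "0 \<le> t \<Longrightarrow> (L t \<longlongrightarrow> L t u) (at_right u)"
  using cadlag_L by (simp add: cadlag_def)

lemma measurable_L: "0 \<le> t \<Longrightarrow> L t \<in> borel_measurable borel"
  using right_continuous_L by (rule right_continuous_borel_measurable)

text \<open>The weak limit vanishes almost everywhere off the range of the path, and right-continuity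
  removes the exceptional set. Zero almost everywhere would not suffice, since \<open>f''\<close> can charge Lebesgue null sets.\<close>

lemma L_support:
  assumes t: "0 \<le> t" and range: "x ` {0..t} \<subseteq> {A..B}" and u: "L t u \<noteq> 0"
  shows "u \<in> {A..B}"
proof (rule ccontr)
  assume "u \<notin> {A..B}"
  then obtain w where w: "u < w" "{u<..<w} \<inter> {A..B} = {}"
    by (cases "u < A") (auto intro: that[of A] that[of "u + 1"])
  have "AE v in lborel. v \<in> {u<..<w} \<longrightarrow> L t v = 0"
    using local_time_AE_eq_0[OF partitions t local_time range] modification_AE_eq[OF modification t]
  proof eventually_elim
    case (elim v)
    then show ?case using w(2) by (cases "v \<in> {A..B}") auto
  qed
  then have "L t u = 0"
    by (rule right_continuous_eq_0[OF right_continuous_L[OF t] _ w(1)])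
  with u show False by contradiction
qed

lemma follmer_sum_tendsto_L:
  fixes F h k :: "real \<Rightarrow> real"
  assumes t: "0 \<le> t" and F: "\<And>u. (F has_real_derivative h u) (at u)"
    and h: "\<And>u. (h has_real_derivative k u) (at u)" and k: "continuous_on UNIV k"
  shows "(\<lambda>n. follmer_sum (\<pi>s n) h x t) \<longlonglongrightarrow>
    F (x t) - F (x 0) - 1 / 2 * (LINT u|lborel. L t u * k u)"
proof -
  obtain A B where range: "x ` {0..t} \<subseteq> {A..B}" using path_range .
  have meas: "L t \<in> borel_measurable borel" "\<Lambda> t \<in> borel_measurable borel" "k \<in> borel_measurable borel"
    using measurable_L[OF t] local_time t k
    by (auto simp: is_pathwise_local_time_def weakly_converges_L1_def
        intro: borel_measurable_continuous_onI dest!: borel_measurable_integrable)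
  have "(LINT u|lborel. \<Lambda> t u * (k u * indicator {A..B} u)) = (LINT u|lborel. L t u * k u)"
  proof (rule integral_cong_AE)
    show "AE u in lborel. \<Lambda> t u * (k u * indicator {A..B} u) = L t u * k u"
      using modification_AE_eq[OF modification t]
    proof eventually_elim
      case (elim u)
      then show ?case using L_support[OF t range, of u] by (cases "L t u = 0") auto
    qed
  qed (use meas in auto)
  then show ?thesis
    using follmer_sum_tendsto[OF partitions t local_time range F h k] by simp
qed

lemma follmer_integral_convolution:
  assumes f: "convex_on UNIV f" and kernel: "smooth_kernel k r" and t: "0 \<le> t"
  shows "follmer_integrable \<pi>s (deriv (convolution k f)) x t"
    and "follmer_integral \<pi>s (deriv (convolution k f)) x t =
      convolution k f (x t) - convolution k f (x 0) -
      1 / 2 * (LINT u|lborel. L t u * convolution (deriv k) (left_deriv f) u)"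
proof -
  have "(convolution k f has_real_derivative deriv (convolution k f) u) (at u)" for u
    using has_derivative_convolution_convex[OF f kernel] unfolding deriv_convolution_convex[OF f kernel] .
  note lim = follmer_sum_tendsto_L[OF t this has_derivative2_convolution_convex[OF f kernel]
      continuous_deriv2_convolution_convex[OF f kernel]]
  show "follmer_integrable \<pi>s (deriv (convolution k f)) x t"
    unfolding follmer_integrable_def using lim by (rule convergentI)
  show "follmer_integral \<pi>s (deriv (convolution k f)) x t =
      convolution k f (x t) - convolution k f (x 0) -
      1 / 2 * (LINT u|lborel. L t u * convolution (deriv k) (left_deriv f) u)"
    unfolding follmer_integral_def using lim by (rule limI)
qed

text \<open>The value that the change of variable formula forces on the integral of the left
  derivative of \<open>f\<close>. No mollifier occurs in it.\<close>

definition tanaka_integral :: "(real \<Rightarrow> real) \<Rightarrow> real \<Rightarrow> real" where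
  "tanaka_integral f t = f (x t) - f (x 0) - 1 / 2 * (LINT u|second_deriv_measure f. L t u)"

lemma integrable_L_second_deriv:
  assumes f: "convex_on UNIV f" and t: "0 \<le> t"
  shows "integrable (second_deriv_measure f) (L t)"
proof -
  obtain A B where range: "x ` {0..t} \<subseteq> {A..B}" using path_range .
  obtain C where C: "\<And>u. u \<in> {A..B} \<Longrightarrow> \<bar>L t u\<bar> \<le> C"
  proof (rule jointly_cadlag_bounded[OF cadlag_imp_jointly_cadlag_const[OF cadlag_L[OF t]]])
    show "compact {t}" "{t} \<subseteq> {0..}" using t by auto
  qed blast
  have "\<bar>L t u\<bar> \<le> \<bar>C\<bar>" for u
    using C[of u] L_support[OF t range, of u] by (cases "L t u = 0") auto
  then show ?thesis
    by (rule integrable_second_deriv[OF f measurable_L[OF t] _ L_support[OF t range]])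
qed

text \<open>The auxiliary family \<open>M\<close> coincides with \<open>L\<close> at the times in \<open>K\<close> only. For \<open>K = {t}\<close> it can be
  taken constant in time, which requires no more than that \<open>L t\<close> is cadlag.\<close>

lemma uniform_limit_follmer_integral:
  assumes f: "convex_on UNIV f"
    and kernel: "\<And>n. smooth_kernel (\<kappa> n) (\<rho> n)" and \<rho>: "\<rho> \<longlonglongrightarrow> 0"
    and M: "jointly_cadlag_continuous M" and K: "compact K" "K \<subseteq> {0..}"
    and eq: "\<And>s. s \<in> K \<Longrightarrow> M s = L s"
  shows "uniform_limit K (\<lambda>n. follmer_integral \<pi>s (deriv (convolution (\<kappa> n) f)) x)
    (tanaka_integral f) sequentially"
proof -
  obtain T where T: "0 \<le> T" "K \<subseteq> {0..T}"
  proof -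
    obtain C where "\<And>s. s \<in> K \<Longrightarrow> \<bar>s\<bar> \<le> C"
      using compact_imp_bounded[OF K(1)] unfolding bounded_iff real_norm_def by blast
    then have "K \<subseteq> {0..\<bar>C\<bar>}" using K(2) by fastforce
    then show ?thesis by (intro that[of "\<bar>C\<bar>"]) auto
  qed
  obtain A B where range: "x ` {0..T} \<subseteq> {A..B}" using path_range .
  have conv: "uniform_limit {A..B} (\<lambda>n. convolution (\<kappa> n) f) f sequentially"
    using uniform_limit_convolution[OF continuous_on_convex[OF f] kernel \<rho>] .
  have 1: "uniform_limit K (\<lambda>n s. convolution (\<kappa> n) f (x s)) (\<lambda>s. f (x s)) sequentially"
    using range T by (intro uniform_limit_compose'[OF conv]) auto
  have 2: "uniform_limit K (\<lambda>n s. convolution (\<kappa> n) f (x 0)) (\<lambda>s. f (x 0)) sequentially"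
    using range T by (intro uniform_limit_compose'[OF conv]) auto
  have sub: "x ` {0..s} \<subseteq> {A..B}" if "s \<in> K" for s
    using range T that by fastforce
  have 3: "uniform_limit K (\<lambda>n s. LINT u|lborel. M s u * convolution (deriv (\<kappa> n)) (left_deriv f) u)
      (\<lambda>s. LINT u|second_deriv_measure f. M s u) sequentially"
  proof (rule uniform_limit_mollified_second_deriv[OF f kernel \<rho> M K])
    fix s assume s: "s \<in> K"
    then have "0 \<le> s" using K by auto
    then show "M s \<in> borel_measurable borel" using measurable_L eq[OF s] by simp
    show "u \<in> {A..B}" if "M s u \<noteq> 0" for u
      using L_support[OF \<open>0 \<le> s\<close> sub[OF s]] that eq[OF s] by simp
  qed
  have "uniform_limit K
      (\<lambda>n s. convolution (\<kappa> n) f (x s) - convolution (\<kappa> n) f (x 0) -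
        1 / 2 * (LINT u|lborel. M s u * convolution (deriv (\<kappa> n)) (left_deriv f) u))
      (\<lambda>s. f (x s) - f (x 0) - 1 / 2 * (LINT u|second_deriv_measure f. M s u)) sequentially"
    by (intro uniform_limit_minus 1 2 bounded_linear.uniform_limit[OF bounded_linear_mult_right] 3)
  then show ?thesis
  proof (rule uniform_limit_cong'[THEN iffD1, rotated 2])
    fix s assume "s \<in> K"
    then have "0 \<le> s" "M s = L s" using K(2) eq by auto
    then show "f (x s) - f (x 0) - 1 / 2 * (LINT u|second_deriv_measure f. M s u) = tanaka_integral f s"
      and "convolution (\<kappa> n) f (x s) - convolution (\<kappa> n) f (x 0) -
          1 / 2 * (LINT u|lborel. M s u * convolution (deriv (\<kappa> n)) (left_deriv f) u) =
        follmer_integral \<pi>s (deriv (convolution (\<kappa> n) f)) x s" for n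
      by (simp_all add: follmer_integral_convolution[OF f kernel] tanaka_integral_def)
  qed
qed

lemma continuous_on_tanaka_integral:
  assumes f: "convex_on UNIV f" and L: "jointly_cadlag_continuous L"
  shows "continuous_on {0..} (tanaka_integral f)"
  unfolding tanaka_integral_def
proof (intro continuous_intros)
  show "continuous_on {0..} (\<lambda>t. f (x t))"
    using continuous_on_compose2[OF continuous_on_convex[OF f] continuous_path] by simp
  show "continuous_on {0..} (\<lambda>t. LINT u|second_deriv_measure f. L t u)"
  proof (rule continuous_on_integral_second_deriv[OF f L measurable_L])
    fix T
    obtain A B where range: "x ` {0..T} \<subseteq> {A..B}" using path_range .
    have "u \<in> {A..B}" if "s \<in> {0..T}" "L s u \<noteq> 0" for s u
      using that range by (intro L_support[of s]) auto
    then show "\<exists>a b. \<forall>s\<in>{0..T}. \<forall>u. L s u \<noteq> 0 \<longrightarrow> u \<in> {a..b}" by blast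
  qed
qed

end

theorem theorem5p2:
  fixes x :: "real \<Rightarrow> real" and \<pi>s :: "nat \<Rightarrow> nat \<Rightarrow> ereal"
    and \<Lambda> L :: "real \<Rightarrow> real \<Rightarrow> real" and f :: "real \<Rightarrow> real"
  assumes "continuous_on {0..} x"
    and "\<forall>n. partition_seq (\<pi>s n)"
    and "\<forall>t\<ge>0. (\<lambda>n. oscillation x (\<pi>s n) t) \<longlonglongrightarrow> 0"
    and "x \<in> L1_paths \<pi>s"
    and "is_pathwise_local_time \<pi>s x \<Lambda>"
    and "is_modification L \<Lambda>"
    and "\<forall>t\<ge>0. cadlag (L t)"
    and "convex_on UNIV f"
  shows "\<exists>I :: real \<Rightarrow> real.
    (\<forall>g. mollifier g \<longrightarrow>
      (\<forall>n\<ge>1. C2 (convolution (scaled g n) f)) \<and>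
      (\<forall>t\<ge>0. (\<forall>n\<ge>1. follmer_integrable \<pi>s (deriv (convolution (scaled g n) f)) x t) \<and>
        (\<lambda>n. follmer_integral \<pi>s (deriv (convolution (scaled g n) f)) x t) \<longlonglongrightarrow> I t)) \<and>
    (\<forall>t\<ge>0. integrable (second_deriv_measure f) (L t) \<and>
      f (x t) - f (x 0) = I t + 1 / 2 * (LINT u|second_deriv_measure f. L t u)) \<and>
    (jointly_cadlag_continuous L \<longrightarrow>
      (\<forall>g. mollifier g \<longrightarrow> (\<forall>K. compact K \<and> K \<subseteq> {0..} \<longrightarrow>
        uniform_limit K
          (\<lambda>n t. follmer_integral \<pi>s (deriv (convolution (scaled g n) f)) x t) I sequentially)) \<and>
      continuous_on {0..} I)"
proof -
  interpret path_with_local_time x \<pi>s \<Lambda> L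
    using assms by unfold_locales auto
  note f = \<open>convex_on UNIV f\<close>
  have uniform: "uniform_limit K (\<lambda>n t. follmer_integral \<pi>s (deriv (convolution (scaled g n) f)) x t)
      (tanaka_integral f) sequentially"
    if g: "mollifier g" and M: "jointly_cadlag_continuous M" "compact K" "K \<subseteq> {0..}"
      "\<And>s. s \<in> K \<Longrightarrow> M s = L s" for g M K
  proof -
    obtain R where R: "\<And>n. 1 \<le> n \<Longrightarrow> smooth_kernel (scaled g n) (R / real n)"
      using mollifier_smooth_kernel[OF g] by blast
    (* The index is shifted because scaled g 0 vanishes identically and is no kernel. *)
    have kernel: "smooth_kernel (scaled g (Suc n)) (R / real (Suc n))" for n
      by (rule R) simp
    have "(\<lambda>n. R / real (Suc n)) \<longlonglongrightarrow> 0"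
      using LIMSEQ_Suc[OF lim_const_over_n] .
    note uniform_limit_follmer_integral[OF f kernel this M]
    then show ?thesis
      unfolding uniform_limit_iff eventually_sequentially_Suc[where P = "\<lambda>n. \<forall>t\<in>K. dist
          (follmer_integral \<pi>s (deriv (convolution (scaled g n) f)) x t) (tanaka_integral f t) < e" for e] .
  qed
  show ?thesis
  proof (intro exI[of _ "tanaka_integral f"] conjI allI impI)
    fix g :: "real \<Rightarrow> real" assume g: "mollifier g"
    obtain R where R: "\<And>n. 1 \<le> n \<Longrightarrow> smooth_kernel (scaled g n) (R / real n)"
      using mollifier_smooth_kernel[OF g] by blast
    show "C2 (convolution (scaled g n) f)" if "1 \<le> n" for n
      using C2_convolution_convex[OF f R[OF that]] .
    fix t :: real assume t: "0 \<le> t"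
    show "follmer_integrable \<pi>s (deriv (convolution (scaled g n) f)) x t" if "1 \<le> n" for n
      using follmer_integral_convolution(1)[OF f R[OF that] t] .
    show "(\<lambda>n. follmer_integral \<pi>s (deriv (convolution (scaled g n) f)) x t) \<longlonglongrightarrow> tanaka_integral f t"
      using uniform[OF g cadlag_imp_jointly_cadlag_const[OF cadlag_L[OF t]], of "{t}"] t
      by (intro tendsto_uniform_limitI[where S = "{t}"]) auto
  next
    fix t :: real assume t: "0 \<le> t"
    show "integrable (second_deriv_measure f) (L t)"
      using integrable_L_second_deriv[OF f t] .
    show "f (x t) - f (x 0) = tanaka_integral f t + 1 / 2 * (LINT u|second_deriv_measure f. L t u)"
      by (simp add: tanaka_integral_def)
  next
    assume L: "jointly_cadlag_continuous L"
    show "uniform_limit K (\<lambda>n t. follmer_integral \<pi>s (deriv (convolution (scaled g n) f)) x t)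
        (tanaka_integral f) sequentially" if "mollifier g" "compact K \<and> K \<subseteq> {0..}" for g K
      using uniform[OF that(1) L] that(2) by blast
    show "continuous_on {0..} (tanaka_integral f)"
      using continuous_on_tanaka_integral[OF f L] .
  qed
qed

end
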